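(* Suppose $G$ is a linear algebraic group over an algebraically closed field $\Bbbk$ (of arbitrary characteristic) such that $\sigma(G)$ is finite. Then the identity component $G^0$ is unipotent, i.e. either $G$ is finite or $G^0$ is infinite unipotent.
   Context: A $G$-module is a finite-dimensional rational representation $V$ of $G$ over $\Bbbk$. $\Bbbk[V]\cong S(V^* )$ is the ring of polynomial functions on $V$, with $G$-action $(g\cdot f)(v)=f(g^{-1}v)$ and invariant ring $\Bbbk[V]^G$, graded by degree. $\Bbbk[V]^G_{\le d}$ is the set of invariants of degree at most $d$. For $S\subseteq \Bbbk[V]$, $S_+$ is the set of elements of $S$ with constant term zero. The nullcone $\mathcal{N}_{G,V}\subseteq V$ is the common zero set of $\Bbbk[V]^G_+$. A subset $S\subseteq\Bbbk[V]^G$ is a $\sigma$-set if for every $v\in V\setminus\mathcal{N}_{G,V}$ there is $f\in S_+$ with $f(v)\neq 0$. Define $\sigma(G,V)=\min\{d\ge 0 : \Bbbk[V]^G_{\le d}\text{ is a }\sigma\text{-set}\}$ and $\sigma(G)=\sup\{\sigma(G,V): V\text{ a }G\text{-module}\}$ (equal to $\infty$ if unbounded). *)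

theory Defs
  imports
    "HOL-Analysis.Abstract_Topology_2"
    "HOL-Library.Poly_Mapping"
    "HOL-Library.Extended_Nat"
    "Jordan_Normal_Form.Determinant"
begin

section \<open>Polynomials and polynomial functions\<close>

text \<open>Polynomials in the variables \<^typ>\<open>'x\<close>: finitely supported functions from
  exponent vectors to coefficients.\<close>

type_synonym ('x, 'k) mpol = "('x \<Rightarrow>\<^sub>0 nat) \<Rightarrow>\<^sub>0 'k"

definition polys_in :: "'x set \<Rightarrow> ('x, 'k::zero) mpol set" where
  "polys_in X = {p. \<forall>m \<in> Poly_Mapping.keys p. Poly_Mapping.keys m \<subseteq> X}"

definition eval_mon :: "('x \<Rightarrow> 'k::comm_semiring_1) \<Rightarrow> ('x \<Rightarrow>\<^sub>0 nat) \<Rightarrow> 'k" where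
  "eval_mon a m = (\<Prod>x \<in> Poly_Mapping.keys m. a x ^ Poly_Mapping.lookup m x)"

definition eval_mpol :: "('x \<Rightarrow> 'k::comm_semiring_1) \<Rightarrow> ('x, 'k) mpol \<Rightarrow> 'k" where
  "eval_mpol a p = (\<Sum>m \<in> Poly_Mapping.keys p. Poly_Mapping.lookup p m * eval_mon a m)"

lemma eval_mpol_superset:
  assumes "finite M" "Poly_Mapping.keys p \<subseteq> M"
  shows "eval_mpol a p = (\<Sum>m \<in> M. Poly_Mapping.lookup p m * eval_mon a m)"
  unfolding eval_mpol_def
  by (rule sum.mono_neutral_left) (use assms in \<open>auto simp: in_keys_iff\<close>)

lemma eval_mpol_zero [simp]: "eval_mpol a 0 = 0"
  by (simp add: eval_mpol_def)

lemma eval_mpol_add: "eval_mpol a (p + q) = eval_mpol a p + eval_mpol a q"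
proof -
  let ?M = "Poly_Mapping.keys p \<union> Poly_Mapping.keys q"
  have "Poly_Mapping.keys (p + q) \<subseteq> ?M" by (rule Poly_Mapping.keys_add)
  then show ?thesis
    by (simp add: eval_mpol_superset[of ?M] lookup_add algebra_simps sum.distrib)
qed

lemma eval_mon_superset:
  assumes "finite X" "Poly_Mapping.keys m \<subseteq> X"
  shows "eval_mon a m = (\<Prod>x \<in> X. a x ^ Poly_Mapping.lookup m x)"
  unfolding eval_mon_def
  by (rule prod.mono_neutral_left) (use assms in \<open>auto simp: in_keys_iff\<close>)

lemma eval_mon_add: "eval_mon a (m + m') = eval_mon a m * eval_mon a m'"
proof -
  let ?X = "Poly_Mapping.keys m \<union> Poly_Mapping.keys m'"
  have "Poly_Mapping.keys (m + m') \<subseteq> ?X" by (rule Poly_Mapping.keys_add)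
  then show ?thesis
    by (simp add: eval_mon_superset[of ?X] lookup_add power_add prod.distrib)
qed

lemma eval_mpol_single: "eval_mpol a (Poly_Mapping.single m c) = c * eval_mon a m"
  by (simp add: eval_mpol_superset[of "{m}"])

lemma eval_mpol_sum: "eval_mpol a (sum f A) = (\<Sum>i \<in> A. eval_mpol a (f i))"
  by (induction A rule: infinite_finite_induct) (simp_all add: eval_mpol_add)

lemma mpol_as_sum:
  "p = (\<Sum>m \<in> Poly_Mapping.keys p. Poly_Mapping.single m (Poly_Mapping.lookup p m))"
  by (rule poly_mapping_eqI)
    (auto simp: lookup_sum lookup_single when_def in_keys_iff)

lemma eval_mpol_mult: "eval_mpol a (p * q) = eval_mpol a p * eval_mpol a q"
proof -
  let ?s = "\<lambda>p m. Poly_Mapping.single m (Poly_Mapping.lookup p m)"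
  have "p * q = (\<Sum>m \<in> Poly_Mapping.keys p. ?s p m) * (\<Sum>m \<in> Poly_Mapping.keys q. ?s q m)"
    by (rule arg_cong2[where f = "(*)", OF mpol_as_sum mpol_as_sum])
  also have "eval_mpol a \<dots> = eval_mpol a p * eval_mpol a q"
    unfolding sum_product eval_mpol_sum mult_single eval_mpol_single eval_mon_add
    by (simp add: eval_mpol_def sum_product mult_ac)
  finally show ?thesis .
qed

lemma polys_in_mult:
  assumes "p \<in> polys_in X" "q \<in> polys_in X"
  shows "p * q \<in> polys_in X"
  unfolding polys_in_def
proof (intro CollectI ballI)
  fix m assume "m \<in> Poly_Mapping.keys (p * q)"
  then obtain m1 m2 where m: "m = m1 + m2"
    "m1 \<in> Poly_Mapping.keys p" "m2 \<in> Poly_Mapping.keys q"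
    using keys_mult[of p q] by auto
  then show "Poly_Mapping.keys m \<subseteq> X"
    using assms Poly_Mapping.keys_add[of m1 m2] by (fastforce simp: polys_in_def)
qed

definition mon_degree :: "('x \<Rightarrow>\<^sub>0 nat) \<Rightarrow> nat" where
  "mon_degree m = (\<Sum>x \<in> Poly_Mapping.keys m. Poly_Mapping.lookup m x)"

definition degree_le :: "nat \<Rightarrow> ('x, 'k::zero) mpol \<Rightarrow> bool" where
  "degree_le d p \<longleftrightarrow> (\<forall>m \<in> Poly_Mapping.keys p. mon_degree m \<le> d)"

definition const_term :: "('x, 'k::zero) mpol \<Rightarrow> 'k" where
  "const_term p = Poly_Mapping.lookup p 0"


section \<open>Linear algebraic groups\<close>

definition GL :: "nat \<Rightarrow> 'k::field mat monoid" where
  "GL n = units_of (ring_mat TYPE('k) n ())"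

abbreviation mat_vars :: "nat \<Rightarrow> (nat \<times> nat) set" where
  "mat_vars n \<equiv> {..<n} \<times> {..<n}"

definition eval_mat :: "'k::field mat \<Rightarrow> (nat \<times> nat, 'k) mpol \<Rightarrow> 'k" where
  "eval_mat A p = eval_mpol (\<lambda>ij. A $$ ij) p"

definition zero_locus_GL :: "nat \<Rightarrow> (nat \<times> nat, 'k::field) mpol set \<Rightarrow> 'k mat set" where
  "zero_locus_GL n P = {A \<in> carrier (GL n). \<forall>p \<in> P. eval_mat A p = 0}"

definition zariski_GL :: "nat \<Rightarrow> 'k::field mat topology" where
  "zariski_GL n = topology (\<lambda>U. \<exists>P \<subseteq> polys_in (mat_vars n).
     U = carrier (GL n) - zero_locus_GL n P)"

lemma istopology_zariski_GL:
  "istopology (\<lambda>U. \<exists>P \<subseteq> polys_in (mat_vars n).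
     U = carrier (GL n :: 'k::field mat monoid) - zero_locus_GL n P)"
  (is "istopology ?open")
  unfolding istopology_def
proof (intro conjI allI impI)
  fix S T :: "'k mat set" assume "?open S" "?open T"
  then obtain P Q where PQ: "P \<subseteq> polys_in (mat_vars n)" "Q \<subseteq> polys_in (mat_vars n)"
    and S: "S = carrier (GL n) - zero_locus_GL n P"
    and T: "T = carrier (GL n) - zero_locus_GL n Q" by auto
  let ?R = "{p * q | p q. p \<in> P \<and> q \<in> Q}"
  have "?R \<subseteq> polys_in (mat_vars n)" using PQ polys_in_mult by blast
  moreover have "S \<inter> T = carrier (GL n) - zero_locus_GL n ?R"
  proof (rule Set.set_eqI, rule iffI)
    fix A assume "A \<in> S \<inter> T"
    then obtain p q where "A \<in> carrier (GL n)" "p \<in> P" "q \<in> Q" "eval_mat A p \<noteq> 0" "eval_mat A q \<noteq> 0"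
      by (auto simp: S T zero_locus_GL_def)
    moreover from this have "eval_mat A (p * q) \<noteq> 0"
      by (simp add: eval_mat_def eval_mpol_mult)
    ultimately show "A \<in> carrier (GL n) - zero_locus_GL n ?R"
      unfolding zero_locus_GL_def by blast
  qed (auto simp: S T zero_locus_GL_def eval_mat_def eval_mpol_mult)
  ultimately show "?open (S \<inter> T)" by blast
next
  fix \<U> :: "'k mat set set" assume "\<forall>U \<in> \<U>. ?open U"
  then obtain P where P: "\<And>U. U \<in> \<U> \<Longrightarrow> P U \<subseteq> polys_in (mat_vars n)"
    "\<And>U. U \<in> \<U> \<Longrightarrow> U = carrier (GL n) - zero_locus_GL n (P U)" by metis
  have "(\<Union>U \<in> \<U>. P U) \<subseteq> polys_in (mat_vars n)" using P(1) by blast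
  moreover have "\<Union>\<U> = (\<Union>U \<in> \<U>. carrier (GL n) - zero_locus_GL n (P U))" using P(2) by auto
  then have "\<Union>\<U> = carrier (GL n) - zero_locus_GL n (\<Union>U \<in> \<U>. P U)"
    by (auto simp: zero_locus_GL_def)
  ultimately show "?open (\<Union>\<U>)" by blast
qed

lemma openin_zariski_GL:
  "openin (zariski_GL n) U \<longleftrightarrow>
     (\<exists>P \<subseteq> polys_in (mat_vars n). U = carrier (GL n) - zero_locus_GL n P)"
  unfolding zariski_GL_def topology_inverse'[OF istopology_zariski_GL] by (rule refl)

lemma topspace_zariski_GL:
  "topspace (zariski_GL n :: 'k::field mat topology) = carrier (GL n)"
proof
  show "topspace (zariski_GL n :: 'k mat topology) \<subseteq> carrier (GL n)"
    using openin_topspace[of "zariski_GL n :: 'k mat topology"] unfolding openin_zariski_GL by blast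
  have "{1 :: (nat \<times> nat, 'k) mpol} \<subseteq> polys_in (mat_vars n)" by (auto simp: polys_in_def)
  moreover have "zero_locus_GL n {1 :: (nat \<times> nat, 'k) mpol} = {}"
    by (simp add: zero_locus_GL_def eval_mat_def eval_mpol_single eval_mon_def flip: single_one)
  ultimately have "openin (zariski_GL n :: 'k mat topology) (carrier (GL n))"
    unfolding openin_zariski_GL by (intro exI[of _ "{1}"]) simp
  then show "carrier (GL n) \<subseteq> topspace (zariski_GL n :: 'k mat topology)" by (rule openin_subset)
qed

lemma closedin_zariski_GL:
  "closedin (zariski_GL n :: 'k::field mat topology) Z \<longleftrightarrow> (\<exists>P \<subseteq> polys_in (mat_vars n). Z = zero_locus_GL n P)"
proof -
  have "zero_locus_GL n P \<subseteq> carrier (GL n)" for P :: "(nat \<times> nat, 'k) mpol set"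
    by (auto simp: zero_locus_GL_def)
  then show ?thesis
    unfolding closedin_def openin_zariski_GL topspace_zariski_GL
    by (metis double_diff subset_refl)
qed

definition linear_algebraic_group :: "nat \<Rightarrow> 'k::field mat set \<Rightarrow> bool" where
  "linear_algebraic_group n G \<longleftrightarrow> subgroup G (GL n) \<and> closedin (zariski_GL n) G"

definition identity_component :: "nat \<Rightarrow> 'k::field mat set \<Rightarrow> 'k mat set" where
  "identity_component n G =
     connected_component_of_set (subtopology (zariski_GL n) G) \<one>\<^bsub>GL n\<^esub>"

definition unipotent_mat :: "nat \<Rightarrow> 'k::field mat \<Rightarrow> bool" where
  "unipotent_mat n A \<longleftrightarrow> A \<in> carrier_mat n n \<and> (\<exists>r. (A - 1\<^sub>m n) ^\<^sub>m r = 0\<^sub>m n n)"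

definition unipotent_group :: "nat \<Rightarrow> 'k::field mat set \<Rightarrow> bool" where
  "unipotent_group n H \<longleftrightarrow> (\<forall>A \<in> H. unipotent_mat n A)"


section \<open>Rational representations\<close>

text \<open>The coordinate ring of the general linear group is generated by the matrix entries and the
  inverse of the determinant; regular functions on a closed subgroup are restrictions of its
  elements.\<close>

definition regular_on :: "nat \<Rightarrow> 'k::field mat set \<Rightarrow> ('k mat \<Rightarrow> 'k) \<Rightarrow> bool" where
  "regular_on n G f \<longleftrightarrow>
     (\<exists>p \<in> polys_in (mat_vars n). \<exists>e. \<forall>A \<in> G. f A = eval_mat A p / det A ^ e)"

text \<open>A \<open>G\<close>-module is given in coordinates: its underlying space is \<^term>\<open>carrier_vec m\<close>,
  and \<open>\<rho>\<close> is the matrix representation.\<close>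

definition G_module :: "nat \<Rightarrow> 'k::field mat set \<Rightarrow> nat \<Rightarrow> ('k mat \<Rightarrow> 'k mat) \<Rightarrow> bool" where
  "G_module n G m \<rho> \<longleftrightarrow>
     \<rho> \<in> hom (GL n\<lparr>carrier := G\<rparr>) (GL m) \<and>
     (\<forall>i < m. \<forall>j < m. regular_on n G (\<lambda>g. \<rho> g $$ (i, j)))"


section \<open>Invariants, the nullcone, and \<open>\<sigma>\<close>\<close>

definition eval_vec :: "'k::field vec \<Rightarrow> (nat, 'k) mpol \<Rightarrow> 'k" where
  "eval_vec v f = eval_mpol (\<lambda>i. v $ i) f"

text \<open>Over an infinite field a polynomial is determined by its values on \<^term>\<open>carrier_vec m\<close>,
  so \<open>g \<cdot> f = f\<close> may be read as an equality of functions.\<close>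

definition invariants ::
  "nat \<Rightarrow> 'k::field mat set \<Rightarrow> nat \<Rightarrow> ('k mat \<Rightarrow> 'k mat) \<Rightarrow> (nat, 'k) mpol set" where
  "invariants n G m \<rho> = {f \<in> polys_in {..<m}.
     \<forall>g \<in> G. \<forall>v \<in> carrier_vec m. eval_vec (\<rho> (inv\<^bsub>GL n\<^esub> g) *\<^sub>v v) f = eval_vec v f}"

definition invariants_le ::
  "nat \<Rightarrow> 'k::field mat set \<Rightarrow> nat \<Rightarrow> ('k mat \<Rightarrow> 'k mat) \<Rightarrow> nat \<Rightarrow> (nat, 'k) mpol set" where
  "invariants_le n G m \<rho> d = {f \<in> invariants n G m \<rho>. degree_le d f}"

definition plus_part :: "(nat, 'k::zero) mpol set \<Rightarrow> (nat, 'k) mpol set" where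
  "plus_part S = {f \<in> S. const_term f = 0}"

definition nullcone ::
  "nat \<Rightarrow> 'k::field mat set \<Rightarrow> nat \<Rightarrow> ('k mat \<Rightarrow> 'k mat) \<Rightarrow> 'k vec set" where
  "nullcone n G m \<rho> =
     {v \<in> carrier_vec m. \<forall>f \<in> plus_part (invariants n G m \<rho>). eval_vec v f = 0}"

definition sigma_set ::
  "nat \<Rightarrow> 'k::field mat set \<Rightarrow> nat \<Rightarrow> ('k mat \<Rightarrow> 'k mat) \<Rightarrow> (nat, 'k) mpol set \<Rightarrow> bool" where
  "sigma_set n G m \<rho> S \<longleftrightarrow> S \<subseteq> invariants n G m \<rho> \<and>
     (\<forall>v \<in> carrier_vec m - nullcone n G m \<rho>. \<exists>f \<in> plus_part S. eval_vec v f \<noteq> 0)"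

text \<open>The minimum is taken in \<^typ>\<open>enat\<close>; by noetherianity the set of admissible
  \<open>d\<close> is never empty.\<close>

definition sigma_module ::
  "nat \<Rightarrow> 'k::field mat set \<Rightarrow> nat \<Rightarrow> ('k mat \<Rightarrow> 'k mat) \<Rightarrow> enat" where
  "sigma_module n G m \<rho> = (INF d \<in> {d. sigma_set n G m \<rho> (invariants_le n G m \<rho> d)}. enat d)"

definition sigma_group :: "nat \<Rightarrow> 'k::field mat set \<Rightarrow> enat" where
  "sigma_group n G = (SUP (m, \<rho>) \<in> {(m, \<rho>). G_module n G m \<rho>}. sigma_module n G m \<rho>)"

end

theory Submission
  imports Defs "Jordan_Normal_Form.Char_Poly" "HOL-Library.Product_Lexorder"
begin

text \<open>Let \<open>\<sigma>(G) \<le> D\<close> and let \<open>\<kappa>\<close> be an eigenvalue of \<open>g \<in> G\<close> on the natural module \<open>V\<close>. Put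
  \<open>d = D + 1\<close> and choose an eigenvector \<open>v\<close> for \<open>\<kappa>\<close> and a generalized eigenvector \<open>l\<close> of \<open>g\<close> on
  \<open>V\<^sup>*\<close> for \<open>\<kappa>\<^bsup>-1\<^esup>\<close> with \<open>l(v) \<noteq> 0\<close>. The evaluation pairing is an invariant of
  \<open>V \<oplus> (V\<^sup>*)\<^bsup>\<otimes>d\<^esup>\<close> that does not vanish at \<open>w = (v, l \<otimes> \<cdots> \<otimes> l)\<close>, so some invariant without constant
  term of degree at most \<open>D\<close> does not vanish at \<open>w\<close> either. On the \<open>g\<close>-orbit of \<open>w\<close>, a monomial of
  bidegree \<open>(a, b)\<close> is multiplied by \<open>\<kappa>\<^bsup>a - db\<^esup>\<close> up to unipotent corrections, hence
  \<open>\<kappa>\<^bsup>a - db\<^esup> = 1\<close> for some \<open>0 < a + b \<le> D\<close>, and \<open>\<kappa>\<close> is a root of unity of order at most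
  \<open>(D + 1)\<^sup>2\<close>. So for each scalar \<open>c\<close> the function \<open>g \<mapsto> det (c - g)\<close> takes only finitely many values
  on \<open>G\<close>, and on the connected set \<open>G\<^sup>0\<close> it equals \<open>(c - 1)\<^sup>n\<close>: all eigenvalues there are \<open>1\<close>.
  That \<open>G\<close> is finite if \<open>G\<^sup>0\<close> is follows since a noetherian space is a finite union of connected
  subsets.\<close>

section \<open>Polynomial functions\<close>

text \<open>Polynomials are handled as functions with a recorded set of variables. Closure rules
  build them, and a formal polynomial is extracted only where a definition asks for one.\<close>

definition polyfun :: "'x set \<Rightarrow> (('x \<Rightarrow> 'k::comm_ring_1) \<Rightarrow> 'k) \<Rightarrow> bool" where
  "polyfun X f \<longleftrightarrow> (\<exists>p \<in> polys_in X. \<forall>a. eval_mpol a p = f a)"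

lemma polyfunE:
  assumes "polyfun X f"
  obtains p where "p \<in> polys_in X" "\<And>a. eval_mpol a p = f a"
  using assms by (auto simp: polyfun_def)

lemma polyfun_const: "polyfun X (\<lambda>a. c)"
  unfolding polyfun_def
  by (rule bexI[of _ "Poly_Mapping.single 0 c"])
    (auto simp: polys_in_def eval_mpol_single eval_mon_def)

lemma polyfun_var: "x \<in> X \<Longrightarrow> polyfun X (\<lambda>a. a x)"
  unfolding polyfun_def
  by (rule bexI[of _ "Poly_Mapping.single (Poly_Mapping.single x 1) 1"])
    (auto simp: polys_in_def eval_mpol_single eval_mon_def)

lemma polyfun_add:
  assumes "polyfun X f" "polyfun X g"
  shows "polyfun X (\<lambda>a. f a + g a)"
proof -
  obtain p q where "p \<in> polys_in X" "q \<in> polys_in X"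
    "\<And>a. eval_mpol a p = f a" "\<And>a. eval_mpol a q = g a"
    using assms by (meson polyfunE)
  moreover from this have "p + q \<in> polys_in X"
    using Poly_Mapping.keys_add[of p q] by (fastforce simp: polys_in_def)
  ultimately show ?thesis
    unfolding polyfun_def by (intro bexI[of _ "p + q"]) (auto simp: eval_mpol_add)
qed

lemma polyfun_mult:
  assumes "polyfun X f" "polyfun X g"
  shows "polyfun X (\<lambda>a. f a * g a)"
proof -
  obtain p q where "p \<in> polys_in X" "q \<in> polys_in X"
    "\<And>a. eval_mpol a p = f a" "\<And>a. eval_mpol a q = g a"
    using assms by (meson polyfunE)
  then show ?thesis
    unfolding polyfun_def
    by (intro bexI[of _ "p * q"]) (auto simp: eval_mpol_mult polys_in_mult)
qed

lemma polyfun_diff: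
  assumes "polyfun X f" "polyfun X g"
  shows "polyfun X (\<lambda>a. f a - g a)"
  using polyfun_add[OF assms(1) polyfun_mult[OF polyfun_const[of X "-1"] assms(2)]] by simp

lemma polyfun_sum: "(\<And>i. i \<in> I \<Longrightarrow> polyfun X (f i)) \<Longrightarrow> polyfun X (\<lambda>a. \<Sum>i\<in>I. f i a)"
  by (induction I rule: infinite_finite_induct) (auto intro: polyfun_const polyfun_add)

lemma polyfun_prod: "(\<And>i. i \<in> I \<Longrightarrow> polyfun X (f i)) \<Longrightarrow> polyfun X (\<lambda>a. \<Prod>i\<in>I. f i a)"
  by (induction I rule: infinite_finite_induct) (auto intro: polyfun_const polyfun_mult)

lemma polyfun_power: "polyfun X f \<Longrightarrow> polyfun X (\<lambda>a. f a ^ k)"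
  by (induction k) (auto intro: polyfun_const polyfun_mult)

lemma polyfun_compose:
  assumes "polyfun Y f" "\<And>y. y \<in> Y \<Longrightarrow> polyfun X (h y)"
  shows "polyfun X (\<lambda>a. f (\<lambda>y. h y a))"
proof -
  obtain p where p: "p \<in> polys_in Y" "\<And>a. eval_mpol a p = f a"
    using assms(1) by (meson polyfunE)
  have "polyfun X (\<lambda>a. eval_mpol (\<lambda>y. h y a) p)"
    unfolding eval_mpol_def eval_mon_def
    using p(1) assms(2)
    by (intro polyfun_sum polyfun_mult polyfun_const polyfun_prod polyfun_power)
      (auto simp: polys_in_def)
  then show ?thesis by (simp add: p(2))
qed

lemma polyfun_det:
  assumes "\<And>i j. i < n \<Longrightarrow> j < n \<Longrightarrow> polyfun X (h (i, j))"
  shows "polyfun X (\<lambda>a. det (mat n n (\<lambda>ij. h ij a)))"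
proof -
  have "polyfun X (\<lambda>a. \<Sum>p\<in>{p. p permutes {0..<n}}. signof p * (\<Prod>i = 0..<n. h (i, p i) a))"
    using assms by (intro polyfun_sum polyfun_mult polyfun_const polyfun_prod) auto
  moreover have "det (mat n n (\<lambda>ij. h ij a)) =
      (\<Sum>p\<in>{p. p permutes {0..<n}}. signof p * (\<Prod>i = 0..<n. h (i, p i) a))" for a
    by (auto simp: det_def intro!: sum.cong prod.cong)
  ultimately show ?thesis by simp
qed

text \<open>At the origin every monomial except \<open>1\<close> vanishes. This gives the constant
  term of a polynomial that is known only through its values.\<close>

lemma const_term_eq_eval_zero:
  fixes p :: "('x, 'k::comm_semiring_1) mpol"
  shows "const_term p = eval_mpol (\<lambda>_. 0) p"
proof -
  have "eval_mon (\<lambda>_. 0 :: 'k) m = (if m = 0 then 1 else 0)" for m :: "'x \<Rightarrow>\<^sub>0 nat"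
  proof (cases "m = 0")
    case False
    then obtain x where "x \<in> Poly_Mapping.keys m" by fastforce
    then have "(\<Prod>x \<in> Poly_Mapping.keys m. (0 :: 'k) ^ Poly_Mapping.lookup m x) = 0"
      by (intro prod_zero bexI[of _ x]) (auto simp: in_keys_iff zero_power)
    then show ?thesis using False by (simp add: eval_mon_def)
  qed (simp add: eval_mon_def)
  then show ?thesis
    by (auto simp: eval_mpol_def const_term_def in_keys_iff if_distrib[of "(*) _"] cong: if_cong)
qed

lemma eval_mpol_cong:
  assumes "p \<in> polys_in X" "\<And>x. x \<in> X \<Longrightarrow> a x = b x"
  shows "eval_mpol a p = eval_mpol b p"
proof -
  have "eval_mon a m = eval_mon b m" if "m \<in> Poly_Mapping.keys p" for m
    unfolding eval_mon_def
  proof (rule prod.cong)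
    fix x assume "x \<in> Poly_Mapping.keys m"
    then have "x \<in> X" using assms(1) that by (auto simp: polys_in_def)
    then show "a x ^ Poly_Mapping.lookup m x = b x ^ Poly_Mapping.lookup m x"
      by (simp add: assms(2))
  qed simp
  then show ?thesis unfolding eval_mpol_def by (intro sum.cong) auto
qed

section \<open>Noetherianity of affine space\<close>

lemma nat_seq_mono_subseq:
  fixes s :: "nat \<Rightarrow> nat"
  shows "\<exists>\<phi> :: nat \<Rightarrow> nat. strict_mono \<phi> \<and> (\<forall>i j. i \<le> j \<longrightarrow> s (\<phi> i) \<le> s (\<phi> j))"
proof -
  \<comment> \<open>\<open>r N\<close> will be a position at or after \<open>N\<close> where the
    tail from \<open>N\<close> is smallest. Restarting just past each chosen position yields
    \<open>\<phi>\<close>, and each chosen value bounds all later ones from below.\<close>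
  have "\<exists>i\<ge>N. \<forall>j\<ge>N. s i \<le> s j" for N
    using ex_has_least_nat[of "\<lambda>i. i \<ge> N" N s] by blast
  then obtain r where r: "\<And>N. r N \<ge> N" "\<And>N j. j \<ge> N \<Longrightarrow> s (r N) \<le> s j" by metis
  define \<phi> where "\<phi> = rec_nat (r 0) (\<lambda>_ k. r (Suc k))"
  have \<phi>: "\<phi> 0 = r 0" "\<phi> (Suc k) = r (Suc (\<phi> k))" for k by (simp_all add: \<phi>_def)
  have mono: "strict_mono \<phi>"
    unfolding strict_mono_Suc_iff using \<phi>(2) r(1) by (simp add: Suc_le_lessD)
  moreover have "s (\<phi> i) \<le> s j" if "j \<ge> \<phi> i" for i j
    using that r by (cases i) (auto simp: \<phi> intro: r(2) order_trans[OF r(1)])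
  then have "s (\<phi> i) \<le> s (\<phi> j)" if "i \<le> j" for i j
    using that mono by (simp add: strict_mono_less_eq)
  ultimately show ?thesis by blast
qed

text \<open>One variable at a time: each new variable thins out the subsequence once more, and the
  monotonicity already achieved survives.\<close>

lemma dickson_subseq:
  fixes c :: "nat \<Rightarrow> 'x \<Rightarrow> nat"
  assumes "finite X"
  shows "\<exists>\<phi> :: nat \<Rightarrow> nat. strict_mono \<phi> \<and> (\<forall>x\<in>X. \<forall>i j. i \<le> j \<longrightarrow> c (\<phi> i) x \<le> c (\<phi> j) x)"
  using assms
proof induction
  case empty
  show ?case by (auto intro!: exI[of _ id] simp: strict_mono_def)
next
  case (insert y X)
  then obtain \<phi> :: "nat \<Rightarrow> nat" where \<phi>: "strict_mono \<phi>"
    "\<forall>x\<in>X. \<forall>i j. i \<le> j \<longrightarrow> c (\<phi> i) x \<le> c (\<phi> j) x" by auto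
  obtain \<psi> :: "nat \<Rightarrow> nat" where \<psi>: "strict_mono \<psi>"
    "\<forall>i j. i \<le> j \<longrightarrow> c (\<phi> (\<psi> i)) y \<le> c (\<phi> (\<psi> j)) y"
    using nat_seq_mono_subseq[of "\<lambda>i. c (\<phi> i) y"] by (elim exE conjE)
  have "strict_mono (\<phi> \<circ> \<psi>)" using \<phi>(1) \<psi>(1) by (simp add: strict_mono_def)
  moreover have "\<psi> i \<le> \<psi> j" if "i \<le> j" for i j
    using that \<psi>(1) by (simp add: strict_mono_less_eq)
  then have "\<forall>x\<in>insert y X. \<forall>i j. i \<le> j \<longrightarrow> c ((\<phi> \<circ> \<psi>) i) x \<le> c ((\<phi> \<circ> \<psi>) j) x"
    using \<phi>(2) \<psi>(2) unfolding o_apply by blast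
  ultimately show ?case by blast
qed

text \<open>Dickson's lemma. The first two terms of the thinned sequence serve as witnesses;
  exponents outside \<open>X\<close> are zero.\<close>

lemma dickson:
  fixes m :: "nat \<Rightarrow> 'x \<Rightarrow>\<^sub>0 nat"
  assumes "finite X" "\<And>i. Poly_Mapping.keys (m i) \<subseteq> X"
  shows "\<exists>i j. i < j \<and> (\<forall>x. Poly_Mapping.lookup (m i) x \<le> Poly_Mapping.lookup (m j) x)"
proof -
  obtain \<phi> :: "nat \<Rightarrow> nat" where \<phi>: "strict_mono \<phi>" "\<forall>x\<in>X. \<forall>i j. i \<le> j \<longrightarrow>
      Poly_Mapping.lookup (m (\<phi> i)) x \<le> Poly_Mapping.lookup (m (\<phi> j)) x"
    using dickson_subseq[OF assms(1), of "\<lambda>i. Poly_Mapping.lookup (m i)"]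
    by (elim exE conjE)
  show ?thesis
  proof (intro exI conjI allI)
    show "\<phi> 0 < \<phi> 1" using \<phi>(1) by (simp add: strict_mono_less)
    show "Poly_Mapping.lookup (m (\<phi> 0)) x \<le> Poly_Mapping.lookup (m (\<phi> 1)) x" for x
    proof (cases "x \<in> X")
      case True
      then show ?thesis using \<phi>(2) by (meson zero_le)
    next
      case False
      then have "Poly_Mapping.lookup (m (\<phi> 0)) x = 0"
        using assms(2)[of "\<phi> 0"] by (meson in_keys_iff subsetD)
      then show ?thesis by (simp only: zero_le)
    qed
  qed
qed

text \<open>Monomials are ordered lexicographically: the least variable in which they differ
  decides. So divisibility implies \<open>\<le>\<close>.\<close>

lemma poly_mapping_le_if_pointwise_le:
  fixes m m' :: "'x::linorder \<Rightarrow>\<^sub>0 nat"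
  assumes "\<And>x. Poly_Mapping.lookup m x \<le> Poly_Mapping.lookup m' x"
  shows "m \<le> m'"
proof (cases "m = m'")
  case False
  let ?D = "{x. Poly_Mapping.lookup m x \<noteq> Poly_Mapping.lookup m' x}"
  have fin: "finite ?D"
    by (rule finite_subset[of _ "Poly_Mapping.keys m \<union> Poly_Mapping.keys m'"])
      (auto simp: in_keys_iff)
  have ne: "?D \<noteq> {}" using False by (auto simp: poly_mapping_eq_iff fun_eq_iff)
  have "Min ?D \<in> ?D" using fin ne by (rule Min_in)
  moreover have "x \<notin> ?D" if "x < Min ?D" for x
    using that fin Min_le not_le by blast
  ultimately have "less_fun (Poly_Mapping.lookup m) (Poly_Mapping.lookup m')"
    using assms[of "Min ?D"] unfolding less_fun_def
    by (metis (mono_tags, lifting) mem_Collect_eq order_le_less)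
  then show ?thesis by (simp add: less_poly_mapping.rep_eq order_less_imp_le)
qed simp

text \<open>By Dickson's lemma an infinite descent would contain a monomial dividing a later,
  smaller one. Finiteness of \<open>X\<close> matters: variables indexed by the naturals form an
  infinite descent themselves.\<close>

lemma wf_monomials:
  fixes X :: "'x::linorder set"
  assumes "finite X"
  shows "wf {(m, m' :: 'x \<Rightarrow>\<^sub>0 nat). m < m' \<and> Poly_Mapping.keys m' \<subseteq> X}"
  unfolding wf_iff_no_infinite_down_chain
proof
  assume "\<exists>f. \<forall>i. (f (Suc i), f i) \<in> {(m, m' :: 'x \<Rightarrow>\<^sub>0 nat). m < m' \<and> Poly_Mapping.keys m' \<subseteq> X}"
  then obtain f :: "nat \<Rightarrow> 'x \<Rightarrow>\<^sub>0 nat" where f: "\<And>i. f (Suc i) < f i" "\<And>i. Poly_Mapping.keys (f i) \<subseteq> X"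
    by auto
  obtain i j where ij: "i < j" "\<forall>x. Poly_Mapping.lookup (f i) x \<le> Poly_Mapping.lookup (f j) x"
    using dickson[of X f, OF assms f(2)] by (elim exE conjE)
  have "f j < f i" using ij(1)
    by (induction rule: less_Suc_induct) (auto intro: less_trans f(1))
  then show False using poly_mapping_le_if_pointwise_le[of "f i" "f j"] ij(2) by simp
qed

text \<open>Cancellation gives \<open>e + l = e + m\<close> only for \<open>l = m\<close>, so a
  single term contributes. Used to cancel leading terms.\<close>

lemma lookup_single_mult:
  fixes p :: "'m::cancel_comm_monoid_add \<Rightarrow>\<^sub>0 'k::comm_semiring_1"
  shows "Poly_Mapping.lookup (Poly_Mapping.single e c * p) (e + m) = c * Poly_Mapping.lookup p m"
proof -
  have "p = (\<Sum>l \<in> Poly_Mapping.keys p. Poly_Mapping.single l (Poly_Mapping.lookup p l))"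
    by (rule poly_mapping_eqI) (auto simp: lookup_sum lookup_single when_def in_keys_iff)
  then have "Poly_Mapping.single e c * p = Poly_Mapping.single e c *
      (\<Sum>l \<in> Poly_Mapping.keys p. Poly_Mapping.single l (Poly_Mapping.lookup p l))"
    by (rule arg_cong)
  also have "\<dots> =
      (\<Sum>l \<in> Poly_Mapping.keys p. Poly_Mapping.single (e + l) (c * Poly_Mapping.lookup p l))"
    by (simp add: sum_distrib_left mult_single)
  finally have "Poly_Mapping.single e c * p =
      (\<Sum>l \<in> Poly_Mapping.keys p. Poly_Mapping.single (e + l) (c * Poly_Mapping.lookup p l))" .
  then show ?thesis
    by (auto simp: lookup_sum lookup_single when_def in_keys_iff)
qed

text \<open>Among the polynomials vanishing on \<open>Z (i + 1)\<close> but not on \<open>Z i\<close> pick \<open>g i\<close> with smallest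
  leading monomial; by Dickson's lemma some \<open>g i\<close> could be used to reduce a later \<open>g j\<close>.\<close>

lemma no_descending_algebraic_sets:
  fixes Z :: "nat \<Rightarrow> ('x::linorder \<Rightarrow> 'k::field) set"
  assumes fin: "finite X"
    and desc: "\<And>i. Z (Suc i) \<subseteq> Z i"
    and sep: "\<And>i. \<exists>f. polyfun X f \<and> (\<forall>a \<in> Z (Suc i). f a = 0) \<and> (\<exists>a \<in> Z i. f a \<noteq> 0)"
  shows False
proof -
  \<comment> \<open>Membership in \<open>I i\<close> is unaffected by adding polynomials in
    \<open>X\<close> that vanish on \<open>Z i\<close>; this is the freedom exploited by the
    reduction.\<close>
  define I where "I i = {p \<in> polys_in X. (\<forall>a \<in> Z (Suc i). eval_mpol a p = 0)
    \<and> (\<exists>a \<in> Z i. eval_mpol a p \<noteq> 0)}" for i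
  define lm :: "('x, 'k) mpol \<Rightarrow> 'x \<Rightarrow>\<^sub>0 nat" where "lm p = Max (Poly_Mapping.keys p)" for p
  have lm_in: "lm p \<in> Poly_Mapping.keys p" if "p \<in> I i" for p i
  proof -
    have "p \<noteq> 0" using that by (auto simp: I_def)
    then show ?thesis unfolding lm_def by (intro Max_in) auto
  qed
  have lm_X: "Poly_Mapping.keys (lm p) \<subseteq> X" if "p \<in> I i" for p i
    using lm_in[OF that] that by (auto simp: I_def polys_in_def)
  have "\<exists>g \<in> I i. \<forall>h \<in> I i. \<not> lm h < lm g" for i
  proof -
    obtain f where f: "polyfun X f" "\<forall>a \<in> Z (Suc i). f a = 0" "\<exists>a \<in> Z i. f a \<noteq> 0"
      using sep[of i] by blast
    obtain p where "p \<in> polys_in X" "\<forall>a. eval_mpol a p = f a"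
      using f(1) unfolding polyfun_def by (elim bexE)
    then have "p \<in> I i" using f(2,3) by (simp add: I_def)
    then have "lm p \<in> lm ` I i" by (rule imageI)
    then obtain m where "m \<in> lm ` I i" "\<And>m'. m' < m \<and> Poly_Mapping.keys m \<subseteq> X \<Longrightarrow> m' \<notin> lm ` I i"
      using wfE_min[OF wf_monomials[OF fin], of "lm p" "lm ` I i"] by auto
    then show ?thesis using lm_X by blast
  qed
  then obtain g where g: "\<And>i. g i \<in> I i" "\<And>i h. h \<in> I i \<Longrightarrow> \<not> lm h < lm (g i)" by metis
  obtain i j where ij: "i < j"
    "\<forall>x. Poly_Mapping.lookup (lm (g i)) x \<le> Poly_Mapping.lookup (lm (g j)) x"
    using dickson[of X "\<lambda>i. lm (g i)", OF fin lm_X[OF g(1)]] by (elim exE conjE)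
  \<comment> \<open>\<open>e\<close> and \<open>c\<close> are chosen so that \<open>q\<close> has
    the same leading term as \<open>g j\<close>; divisibility makes the subtraction exact.\<close>
  define e where "e = lm (g j) - lm (g i)"
  define c where "c = Poly_Mapping.lookup (g j) (lm (g j)) / Poly_Mapping.lookup (g i) (lm (g i))"
  define q where "q = Poly_Mapping.single e c * g i"
  define h where "h = g j - q"
  have e: "lm (g j) = e + lm (g i)"
    unfolding e_def by (rule poly_mapping_eqI) (simp add: lookup_add lookup_minus ij(2))
  have keys_q: "Poly_Mapping.keys q \<subseteq> {e + m | m. m \<in> Poly_Mapping.keys (g i)}"
    unfolding q_def using keys_mult[of "Poly_Mapping.single e c" "g i"] by (auto split: if_splits)
  have keys_h: "Poly_Mapping.keys h \<subseteq> Poly_Mapping.keys (g j) \<union> Poly_Mapping.keys q"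
    unfolding h_def by (auto simp: in_keys_iff lookup_minus)
  have q_X: "q \<in> polys_in X"
  proof -
    have "Poly_Mapping.keys e \<subseteq> Poly_Mapping.keys (lm (g j))"
      unfolding e_def by (auto simp: in_keys_iff lookup_minus)
    then have "Poly_Mapping.single e c \<in> polys_in X"
      using lm_X[OF g(1), of j] by (auto simp: polys_in_def)
    then show ?thesis unfolding q_def using g(1)[of i] by (intro polys_in_mult) (auto simp: I_def)
  qed
  \<comment> \<open>Because \<open>i < j\<close>, both \<open>Z j\<close> and
    \<open>Z (Suc j)\<close> lie in \<open>Z (Suc i)\<close>, where \<open>g i\<close> and hence
    \<open>q\<close> vanish. So \<open>h\<close> agrees with \<open>g j\<close> there and belongs to
    \<open>I j\<close>.\<close>
  have chain: "Z k \<subseteq> Z (Suc i)" if "Suc i \<le> k" for k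
    using lift_Suc_antimono_le[of Z, OF desc that] .
  have q_eval: "eval_mpol a q = 0" if "a \<in> Z k" "i < k" for a k
    using chain[of k] that g(1)[of i] by (auto simp: q_def eval_mpol_mult I_def)
  have h_eval: "eval_mpol a h = eval_mpol a (g j)" if "a \<in> Z k" "i < k" for a k
  proof -
    have "eval_mpol a (g j) = eval_mpol a h + eval_mpol a q"
      unfolding eval_mpol_add[symmetric] by (simp add: h_def)
    then show ?thesis using q_eval[OF that] by simp
  qed
  have "h \<in> polys_in X"
    using keys_h q_X g(1)[of j] by (auto simp: I_def polys_in_def)
  then have hI: "h \<in> I j"
    using g(1)[of j] ij(1) h_eval[of _ j] h_eval[of _ "Suc j"] unfolding I_def by auto
  \<comment> \<open>Addition respects the order of monomials, so no monomial of \<open>q\<close>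
    exceeds \<open>lm (g j)\<close>, and the coefficient at \<open>lm (g j)\<close> cancels in
    \<open>h\<close>. This contradicts the minimal choice of \<open>g j\<close>.\<close>
  have "lm h < lm (g j)"
  proof -
    have lq: "Poly_Mapping.lookup q (lm (g j)) = Poly_Mapping.lookup (g j) (lm (g j))"
      unfolding q_def e lookup_single_mult using lm_in[OF g(1), of i] by (simp add: c_def e in_keys_iff)
    have "m \<le> lm (g j)" if "m \<in> Poly_Mapping.keys h" for m
    proof -
      have "m \<in> Poly_Mapping.keys (g j) \<or> (\<exists>m'\<in>Poly_Mapping.keys (g i). m = e + m')"
        using that keys_h keys_q by blast
      then show ?thesis
      proof
        assume "\<exists>m'\<in>Poly_Mapping.keys (g i). m = e + m'"
        then show ?thesis unfolding e by (auto simp: lm_def intro!: add_left_mono)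
      qed (simp add: lm_def)
    qed
    moreover have "lm (g j) \<notin> Poly_Mapping.keys h"
      using lq by (simp add: h_def in_keys_iff lookup_minus)
    ultimately show ?thesis using lm_in[OF hI] by (metis order_le_less)
  qed
  then show False using g(2)[OF hI] by blast
qed

section \<open>The Zariski topology on the general linear group\<close>

lemma carrier_GL:
  "carrier (GL n) = {A \<in> carrier_mat n n. \<exists>B \<in> carrier_mat n n. B * A = 1\<^sub>m n \<and> A * B = 1\<^sub>m n}"
  by (simp add: GL_def units_of_def Units_def ring_mat_def)

lemma carrier_GL_mat: "A \<in> carrier (GL n) \<Longrightarrow> A \<in> carrier_mat n n"
  by (simp add: carrier_GL)

lemma mult_GL [simp]: "A \<otimes>\<^bsub>GL n\<^esub> B = A * B"
  by (simp add: GL_def units_of_def ring_mat_def)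

lemma one_GL [simp]: "\<one>\<^bsub>GL n\<^esub> = 1\<^sub>m n"
  by (simp add: GL_def units_of_def ring_mat_def)

lemma group_GL: "group (GL n :: 'k::field mat monoid)"
proof -
  interpret ring "ring_mat TYPE('k) n ()" by (rule ring_mat)
  show ?thesis unfolding GL_def by (rule units_group)
qed

lemma inv_GL:
  assumes "A \<in> carrier (GL n)"
  shows "inv\<^bsub>GL n\<^esub> A \<in> carrier (GL n)" "inv\<^bsub>GL n\<^esub> A \<in> carrier_mat n n"
    "inv\<^bsub>GL n\<^esub> A * A = 1\<^sub>m n" "A * inv\<^bsub>GL n\<^esub> A = 1\<^sub>m n"
  using group.inv_closed[OF group_GL assms] group.l_inv[OF group_GL assms]
    group.r_inv[OF group_GL assms] carrier_GL_mat by auto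

lemma det_GL:
  assumes "A \<in> carrier (GL n)"
  shows "det A \<noteq> 0"
proof -
  have "det A * det (inv\<^bsub>GL n\<^esub> A) = 1"
    using det_mult[OF carrier_GL_mat[OF assms] inv_GL(2)[OF assms]] inv_GL(4)[OF assms] by simp
  then show ?thesis by auto
qed

lemma closedin_polyfun:
  fixes f :: "(nat \<times> nat \<Rightarrow> 'k::field) \<Rightarrow> 'k"
  assumes "polyfun (mat_vars n) f"
  shows "closedin (zariski_GL n) {A \<in> carrier (GL n). f (($$) A) = 0}"
proof -
  obtain p where "p \<in> polys_in (mat_vars n)" "\<forall>a. eval_mpol a p = f a"
    using assms unfolding polyfun_def by (elim bexE)
  then show ?thesis
    unfolding closedin_zariski_GL
    by (intro exI[of _ "{p}"]) (auto simp: zero_locus_GL_def eval_mat_def)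
qed

text \<open>Noetherianity as well-foundedness. In a strict chain some equation of the smaller closed
  set fails at a point of the larger one, which is the separation excluded by
  \<open>no_descending_algebraic_sets\<close>.\<close>

lemma wf_zariski_closed:
  "wf {(Z', Z). closedin (zariski_GL n :: 'k::field mat topology) Z' \<and> Z' \<subset> Z}"
  unfolding wf_iff_no_infinite_down_chain
proof
  assume "\<exists>Z. \<forall>i. (Z (Suc i), Z i) \<in>
    {(Z', Z). closedin (zariski_GL n :: 'k mat topology) Z' \<and> Z' \<subset> Z}"
  then obtain Z where "\<forall>i. (Z (Suc i), Z i) \<in>
    {(Z', Z). closedin (zariski_GL n :: 'k mat topology) Z' \<and> Z' \<subset> Z}" by (elim exE)
  then have Z: "\<And>i. closedin (zariski_GL n :: 'k mat topology) (Z (Suc i))"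
      "\<And>i. Z (Suc i) \<subset> Z i"
    by auto
  \<comment> \<open>The relation makes only its smaller member closed, so the first set of the chain
    is dropped.\<close>
  show False
  proof (rule no_descending_algebraic_sets[of "mat_vars n" "\<lambda>i. ($$) ` Z (Suc i)"])
    fix i
    show "($$) ` Z (Suc (Suc i)) \<subseteq> ($$) ` Z (Suc i)" using Z(2)[of "Suc i"] by blast
    obtain P where P: "P \<subseteq> polys_in (mat_vars n)" "Z (Suc (Suc i)) = zero_locus_GL n P"
      using Z(1) unfolding closedin_zariski_GL by blast
    obtain A where A: "A \<in> Z (Suc i)" "A \<notin> Z (Suc (Suc i))" using Z(2) by blast
    have "A \<in> carrier (GL n)"
      using A(1) closedin_subset[OF Z(1)[of i]] by (auto simp: topspace_zariski_GL)
    then obtain p where p: "p \<in> P" "eval_mat A p \<noteq> 0"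
      using A(2) unfolding P(2) zero_locus_GL_def by blast
    have "polyfun (mat_vars n) (\<lambda>a. eval_mpol a p)"
      using p(1) P(1) unfolding polyfun_def by blast
    moreover have "\<forall>a \<in> ($$) ` Z (Suc (Suc i)). eval_mpol a p = 0"
      using p(1) unfolding P(2) zero_locus_GL_def eval_mat_def by blast
    moreover have "\<exists>a \<in> ($$) ` Z (Suc i). eval_mpol a p \<noteq> 0"
      using p(2) A(1) unfolding eval_mat_def by blast
    ultimately show "\<exists>f. polyfun (mat_vars n) f \<and> (\<forall>a \<in> ($$) ` Z (Suc (Suc i)). f a = 0)
        \<and> (\<exists>a \<in> ($$) ` Z (Suc i). f a \<noteq> 0)"
      by blast
  qed simp
qed

section \<open>Connected subsets and the identity component\<close>

text \<open>Noetherian induction: a closed set that is not connected is the union of two proper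
  closed subsets, to which the induction hypothesis applies.\<close>

lemma zariski_closed_finite_union_connected:
  assumes "closedin (zariski_GL n :: 'k::field mat topology) Z"
  shows "\<exists>F. finite F \<and> (\<forall>C \<in> F. connectedin (zariski_GL n) C) \<and> Z = \<Union>F"
  using assms
proof (induction Z rule: wf_induct_rule[OF wf_zariski_closed[of n]])
  case (1 Z)
  show ?case
  proof (cases "connectedin (zariski_GL n) Z")
    case True
    then show ?thesis by (intro exI[of _ "{Z}"]) simp
  next
    case False
    then obtain E1 E2 where E: "closedin (zariski_GL n) E1" "closedin (zariski_GL n) E2"
      "Z \<subseteq> E1 \<union> E2" "E1 \<inter> E2 \<inter> Z = {}" "E1 \<inter> Z \<noteq> {}" "E2 \<inter> Z \<noteq> {}"
      using closedin_subset[OF 1(2)] unfolding connectedin_closedin by blast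
    have "closedin (zariski_GL n) (E1 \<inter> Z)" "closedin (zariski_GL n) (E2 \<inter> Z)"
      using E(1,2) 1(2) by (auto intro: closedin_Int)
    moreover have "E1 \<inter> Z \<subset> Z" "E2 \<inter> Z \<subset> Z" using E(4-6) by auto
    ultimately obtain F1 F2 where
      "finite F1" "\<forall>C \<in> F1. connectedin (zariski_GL n) C" "E1 \<inter> Z = \<Union>F1"
      "finite F2" "\<forall>C \<in> F2. connectedin (zariski_GL n) C" "E2 \<inter> Z = \<Union>F2"
      using 1(1)[of "E1 \<inter> Z"] 1(1)[of "E2 \<inter> Z"] by auto
    moreover have "Z = (E1 \<inter> Z) \<union> (E2 \<inter> Z)" using E(3) by blast
    ultimately show ?thesis by (intro exI[of _ "F1 \<union> F2"]) auto
  qed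
qed

text \<open>The entries of \<open>H * A\<close> are linear in those of \<open>A\<close>, so
  equations pull back to equations by substitution.\<close>

lemma continuous_map_left_translation:
  fixes H :: "'k::field mat"
  assumes H: "H \<in> carrier (GL n)"
  shows "continuous_map (zariski_GL n) (zariski_GL n) ((*) H)"
  unfolding continuous_map_closedin topspace_zariski_GL
proof (intro conjI allI impI)
  interpret group "GL n :: 'k mat monoid" by (rule group_GL)
  show closed: "(*) H \<in> carrier (GL n) \<rightarrow> carrier (GL n)"
    using m_closed[OF H] by auto
  fix Z :: "'k mat set" assume "closedin (zariski_GL n) Z"
  then obtain P where P: "P \<subseteq> polys_in (mat_vars n)" "Z = zero_locus_GL n P"
    unfolding closedin_zariski_GL by blast
  have "\<exists>q \<in> polys_in (mat_vars n). \<forall>A \<in> carrier (GL n). eval_mat A q = eval_mat (H * A) p"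
    if "p \<in> P" for p
  proof -
    have p: "p \<in> polys_in (mat_vars n)" using that P(1) by blast
    then have "polyfun (mat_vars n) (\<lambda>a. eval_mpol a p)" unfolding polyfun_def by blast
    then have "polyfun (mat_vars n)
        (\<lambda>a. eval_mpol (\<lambda>ij. \<Sum>l = 0..<n. H $$ (fst ij, l) * a (l, snd ij)) p)"
      by (rule polyfun_compose)
        (auto intro!: polyfun_sum polyfun_mult polyfun_const polyfun_var)
    then obtain q where q: "q \<in> polys_in (mat_vars n)" "\<forall>a. eval_mpol a q =
        eval_mpol (\<lambda>ij. \<Sum>l = 0..<n. H $$ (fst ij, l) * a (l, snd ij)) p"
      unfolding polyfun_def by (elim bexE)
    \<comment> \<open>Matrix entries are specified only inside the index range; agreement on
      \<open>mat_vars n\<close> suffices because \<open>p\<close> has no other variables.\<close>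
    moreover have "eval_mat A q = eval_mat (H * A) p" if "A \<in> carrier (GL n)" for A
      unfolding eval_mat_def q(2)[rule_format]
      using carrier_GL_mat[OF that] carrier_GL_mat[OF H]
      by (intro eval_mpol_cong[OF p]) (auto simp: scalar_prod_def)
    ultimately show ?thesis by blast
  qed
  then obtain q where q: "\<forall>p \<in> P. q p \<in> polys_in (mat_vars n) \<and>
      (\<forall>A \<in> carrier (GL n). eval_mat A (q p) = eval_mat (H * A) p)"
    by metis
  have "{A \<in> carrier (GL n). H * A \<in> Z} = zero_locus_GL n (q ` P)"
    unfolding P(2) zero_locus_GL_def using q closed by auto
  then show "closedin (zariski_GL n) {A \<in> carrier (GL n). H * A \<in> Z}"
    unfolding closedin_zariski_GL using q by (intro exI[of _ "q ` P"]) auto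
qed

text \<open>Write \<open>G\<close> as a finite union of connected sets. Translating such a set by
  the inverse of one of its elements is injective and gives a connected set through the identity,
  which lies in the identity component.\<close>

lemma finite_if_finite_identity_component:
  fixes G :: "'k::field mat set"
  assumes G: "linear_algebraic_group n G" and fin: "finite (identity_component n G)"
  shows "finite G"
proof -
  interpret group "GL n :: 'k mat monoid" by (rule group_GL)
  have sub: "subgroup G (GL n)" using G by (simp add: linear_algebraic_group_def)
  obtain F where F: "finite F" "\<forall>C \<in> F. connectedin (zariski_GL n) C" "G = \<Union>F"
    using zariski_closed_finite_union_connected G unfolding linear_algebraic_group_def by blast
  have "finite C" if C: "C \<in> F" for C
  proof (cases "C = {}")
    case False
    then obtain g where g: "g \<in> C" by blast
    then have gG: "g \<in> G" using C F(3) by blast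
    have gGL: "g \<in> carrier (GL n)" using gG subgroup.subset[OF sub] by blast
    let ?h = "inv\<^bsub>GL n\<^esub> g"
    have hG: "?h \<in> G" by (rule subgroup.m_inv_closed[OF sub gG])
    have "connectedin (zariski_GL n) ((*) ?h ` C)"
      by (rule connectedin_continuous_map_image[OF continuous_map_left_translation])
        (use F(2) C inv_GL(1)[OF gGL] in auto)
    moreover have "(*) ?h ` C \<subseteq> G"
    proof
      fix x assume "x \<in> (*) ?h ` C"
      then obtain y where "y \<in> G" "x = ?h * y" using C F(3) by blast
      then show "x \<in> G" using subgroup.m_closed[OF sub hG, of y] by simp
    qed
    moreover have "1\<^sub>m n \<in> (*) ?h ` C" using inv_GL(3)[OF gGL] g by (metis imageI)
    ultimately have "(*) ?h ` C \<subseteq> identity_component n G"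
      unfolding identity_component_def one_GL
      by (intro connected_component_of_maximal) (auto simp: connectedin_subtopology)
    then have "finite ((*) ?h ` C)" using fin finite_subset by blast
    moreover have "inj_on ((*) ?h) C"
    proof (rule inj_onI)
      fix x y assume xy: "x \<in> C" "y \<in> C" "?h * x = ?h * y"
      then have "x \<in> carrier (GL n)" "y \<in> carrier (GL n)"
        using C F(3) subgroup.subset[OF sub] by blast+
      then show "x = y" using Units_l_cancel[of ?h x y] xy(3) inv_GL(1)[OF gGL] by (simp add: Units_eq)
    qed
    ultimately show ?thesis by (rule finite_imageD)
  qed simp
  then show ?thesis using F(1,3) by simp
qed

text \<open>A fibre of \<open>f\<close> is closed, and so is a union of finitely many fibres. With
  finitely many values these would disconnect a connected set on which \<open>f\<close> is not
  constant.\<close>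

lemma finite_valued_polyfun_const_on_identity_component:
  fixes f :: "(nat \<times> nat \<Rightarrow> 'k::field) \<Rightarrow> 'k"
  assumes G: "linear_algebraic_group n G"
    and f: "polyfun (mat_vars n) f" and fin: "finite ((\<lambda>A. f (($$) A)) ` G)"
    and A: "A \<in> identity_component n G"
  shows "f (($$) A) = f (($$) (1\<^sub>m n))"
proof (rule ccontr)
  assume neq: "f (($$) A) \<noteq> f (($$) (1\<^sub>m n))"
  let ?c = "f (($$) (1\<^sub>m n))"
  obtain T where T: "connectedin (subtopology (zariski_GL n) G) T" "1\<^sub>m n \<in> T" "A \<in> T"
    using A by (auto simp: identity_component_def connected_component_of_def)
  then have TG: "connectedin (zariski_GL n) T" "T \<subseteq> G" by (auto simp: connectedin_subtopology)
  have T_GL: "T \<subseteq> carrier (GL n)"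
    using connectedin_subset_topspace[OF TG(1)] by (simp add: topspace_zariski_GL)
  \<comment> \<open>\<open>V\<close> collects the values other than the one at the identity.
    Vanishing of the product over \<open>V\<close> expresses that one of them is attained.\<close>
  define V where "V = (\<lambda>A. f (($$) A)) ` G - {?c}"
  define E1 where "E1 = {A \<in> carrier (GL n). f (($$) A) - ?c = 0}"
  define E2 where "E2 = {A \<in> carrier (GL n). (\<Prod>c \<in> V. f (($$) A) - c) = 0}"
  have "finite V" using fin by (simp add: V_def)
  have "closedin (zariski_GL n) E1"
    unfolding E1_def by (intro closedin_polyfun polyfun_diff f polyfun_const)
  moreover have "closedin (zariski_GL n) E2"
    unfolding E2_def by (intro closedin_polyfun polyfun_prod polyfun_diff f polyfun_const)
  moreover have "T \<subseteq> E1 \<union> E2"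
  proof
    fix B assume B: "B \<in> T"
    then have "f (($$) B) = ?c \<or> f (($$) B) \<in> V" using TG(2) by (auto simp: V_def)
    then show "B \<in> E1 \<union> E2"
      using B T_GL \<open>finite V\<close> by (auto simp: E1_def E2_def)
  qed
  moreover have "E1 \<inter> E2 \<inter> T = {}"
    using \<open>finite V\<close> by (auto simp: E1_def E2_def V_def)
  moreover have "E1 \<inter> T \<noteq> {}" using T(2) T_GL by (auto simp: E1_def)
  moreover have "E2 \<inter> T \<noteq> {}"
  proof -
    have "A \<in> E2" using T(3) T_GL TG(2) neq \<open>finite V\<close> by (auto simp: E2_def V_def)
    then show ?thesis using T(3) by blast
  qed
  ultimately show False using TG(1) unfolding connectedin_closedin by blast
qed

section \<open>Sequences annihilated by powers of a shifted shift operator\<close>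

text \<open>As an operator this is \<open>E - \<alpha>\<close> with \<open>E\<close> the shift, so
  all twists commute and their products are polynomials in \<open>E\<close>.\<close>

definition twist :: "'k::comm_ring_1 \<Rightarrow> (nat \<Rightarrow> 'k) \<Rightarrow> nat \<Rightarrow> 'k" where
  "twist \<alpha> s = (\<lambda>k. s (Suc k) - \<alpha> * s k)"

text \<open>In characteristic zero and for \<open>\<alpha> \<noteq> 0\<close> these are the sequences \<open>k \<mapsto> \<alpha>\<^sup>k p(k)\<close> with \<open>p\<close> a
  polynomial.\<close>

definition quasi_geometric :: "'k::comm_ring_1 \<Rightarrow> (nat \<Rightarrow> 'k) \<Rightarrow> bool" where
  "quasi_geometric \<alpha> s \<longleftrightarrow> (\<exists>r. (twist \<alpha> ^^ r) s = (\<lambda>_. 0))"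

lemma twist_zero: "(twist \<alpha> ^^ r) (\<lambda>_. 0) = (\<lambda>_. 0)"
  by (induction r) (auto simp: twist_def)

lemma twist_add: "(twist \<alpha> ^^ r) (\<lambda>k. s k + t k) = (\<lambda>k. (twist \<alpha> ^^ r) s k + (twist \<alpha> ^^ r) t k)"
  by (induction r) (auto simp: twist_def algebra_simps)

lemma twist_scale: "(twist \<alpha> ^^ r) (\<lambda>k. c * s k) = (\<lambda>k. c * (twist \<alpha> ^^ r) s k)"
  by (induction r) (auto simp: twist_def algebra_simps)

lemma twist_sum: "(twist \<alpha> ^^ r) (\<lambda>k. \<Sum>i\<in>I. s i k) = (\<lambda>k. \<Sum>i\<in>I. (twist \<alpha> ^^ r) (s i) k)"
  by (induction I rule: infinite_finite_induct) (simp_all add: twist_zero twist_add)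

lemma twist_shift: "(twist \<alpha> ^^ r) (\<lambda>k. s (Suc k)) = (\<lambda>k. (twist \<alpha> ^^ r) s (Suc k))"
  by (induction r) (auto simp: twist_def)

lemma twist_commute: "(twist \<alpha> ^^ r) ((twist \<beta> ^^ q) s) = (twist \<beta> ^^ q) ((twist \<alpha> ^^ r) s)"
proof -
  have "twist \<alpha> (twist \<beta> s) = twist \<beta> (twist \<alpha> s)" for s
    by (auto simp: twist_def algebra_simps)
  then have "twist \<alpha> ((twist \<beta> ^^ q) s) = (twist \<beta> ^^ q) (twist \<alpha> s)" for s
    by (induction q) simp_all
  then show ?thesis by (induction r) simp_all
qed

text \<open>A Leibniz rule: \<open>twist (\<alpha> * \<beta>)\<close> turns \<open>s * t\<close>
  into \<open>twist \<alpha> s\<close> times the shift of \<open>t\<close>, plus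
  \<open>\<alpha>\<close> times \<open>s\<close> times \<open>twist \<beta> t\<close>. Either
  summand needs one power less, so induction on \<open>r + q\<close> applies.\<close>

lemma twist_mult:
  assumes "(twist \<alpha> ^^ r) s = (\<lambda>_. 0)" "(twist \<beta> ^^ q) t = (\<lambda>_. 0)"
  shows "(twist (\<alpha> * \<beta>) ^^ (r + q)) (\<lambda>k. s k * t k) = (\<lambda>_. 0)"
  using assms
proof (induction "r + q" arbitrary: r q s t)
  case 0
  then show ?case by (simp add: fun_eq_iff)
next
  case (Suc l)
  show ?case
  proof (cases "r = 0 \<or> q = 0")
    case True
    then have "(\<lambda>k. s k * t k) = (\<lambda>_. 0)" using Suc.prems by (auto simp: fun_eq_iff)
    then show ?thesis by (simp add: twist_zero)
  next
    case False
    then obtain r' q' where r': "r = Suc r'" and q': "q = Suc q'"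
      using not0_implies_Suc by blast
    have s: "(twist \<alpha> ^^ r') (twist \<alpha> s) = (\<lambda>_. 0)"
      using Suc.prems(1) unfolding r' by (simp add: funpow_swap1)
    have t: "(twist \<beta> ^^ q') (twist \<beta> t) = (\<lambda>_. 0)"
      using Suc.prems(2) unfolding q' by (simp add: funpow_swap1)
    have "(twist \<beta> ^^ q) (\<lambda>k. t (Suc k)) = (\<lambda>_. 0)"
      using Suc.prems(2) by (simp only: twist_shift)
    then have 1: "(twist (\<alpha> * \<beta>) ^^ l) (\<lambda>k. twist \<alpha> s k * t (Suc k)) = (\<lambda>_. 0)"
      using Suc.hyps(1)[of r' q, OF _ s] Suc.hyps(2) r' by simp
    have 2: "(twist (\<alpha> * \<beta>) ^^ l) (\<lambda>k. s k * twist \<beta> t k) = (\<lambda>_. 0)"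
      using Suc.hyps(1)[OF _ Suc.prems(1) t] Suc.hyps(2) q' by simp
    have "twist (\<alpha> * \<beta>) (\<lambda>k. s k * t k) =
        (\<lambda>k. twist \<alpha> s k * t (Suc k) + \<alpha> * (s k * twist \<beta> t k))"
      by (auto simp: twist_def algebra_simps)
    then have "(twist (\<alpha> * \<beta>) ^^ Suc l) (\<lambda>k. s k * t k) = (\<lambda>_. 0)"
      by (simp add: funpow_swap1 twist_add twist_scale 1 2)
    then show ?thesis by (simp only: Suc.hyps(2))
  qed
qed

lemma quasi_geometric_mult:
  "quasi_geometric \<alpha> s \<Longrightarrow> quasi_geometric \<beta> t \<Longrightarrow> quasi_geometric (\<alpha> * \<beta>) (\<lambda>k. s k * t k)"
  unfolding quasi_geometric_def using twist_mult by blast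

lemma quasi_geometric_one: "quasi_geometric 1 (\<lambda>_. 1)"
  unfolding quasi_geometric_def by (rule exI[of _ 1]) (simp add: twist_def)

lemma quasi_geometric_power:
  "quasi_geometric \<alpha> s \<Longrightarrow> quasi_geometric (\<alpha> ^ e) (\<lambda>k. s k ^ e)"
  by (induction e) (auto intro: quasi_geometric_one quasi_geometric_mult)

lemma quasi_geometric_prod:
  "(\<And>i. i \<in> I \<Longrightarrow> quasi_geometric (\<alpha> i) (s i)) \<Longrightarrow>
    quasi_geometric (\<Prod>i\<in>I. \<alpha> i) (\<lambda>k. \<Prod>i\<in>I. s i k)"
  by (induction I rule: infinite_finite_induct)
    (auto intro: quasi_geometric_one quasi_geometric_mult)

lemma quasi_geometric_scale: "quasi_geometric \<alpha> s \<Longrightarrow> quasi_geometric \<alpha> (\<lambda>k. c * s k)"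
  unfolding quasi_geometric_def by (elim exE) (metis mult_zero_right twist_scale)

text \<open>A power of \<open>twist (\<alpha> j)\<close> removes the summand \<open>j\<close>, keeps
  the other summands quasi-geometric with their old ratios, and multiplies the constant by a power
  of \<open>1 - \<alpha> j\<close>, which is nonzero.\<close>

lemma sum_quasi_geometric_const:
  fixes c :: "'k::field"
  assumes "finite I" "\<And>i. i \<in> I \<Longrightarrow> quasi_geometric (\<alpha> i) (s i)" "\<And>i. i \<in> I \<Longrightarrow> \<alpha> i \<noteq> 1"
    and "\<And>k. (\<Sum>i\<in>I. s i k) = c"
  shows "c = 0"
  using assms
proof (induction I arbitrary: s c)
  case empty
  then show ?case by simp
next
  case (insert j I)
  obtain r where r: "(twist (\<alpha> j) ^^ r) (s j) = (\<lambda>_. 0)"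
    using insert.prems(1)[of j] by (auto simp: quasi_geometric_def)
  have const: "(twist \<beta> ^^ q) (\<lambda>_. d) = (\<lambda>_. (1 - \<beta>) ^ q * d)" for \<beta> q and d :: 'k
    by (induction q) (auto simp: twist_def algebra_simps)
  have "(\<lambda>k. \<Sum>i\<in>insert j I. s i k) = (\<lambda>_. c)" using insert.prems(3) by auto
  then have "(\<lambda>k. \<Sum>i\<in>insert j I. (twist (\<alpha> j) ^^ r) (s i) k) = (\<lambda>_. (1 - \<alpha> j) ^ r * c)"
    unfolding twist_sum[symmetric] const[symmetric] by (rule arg_cong)
  then have "(\<Sum>i\<in>I. (twist (\<alpha> j) ^^ r) (s i) k) = (1 - \<alpha> j) ^ r * c" for k
    using insert.hyps r by (simp add: fun_eq_iff)
  moreover have "quasi_geometric (\<alpha> i) ((twist (\<alpha> j) ^^ r) (s i))" if "i \<in> I" for i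
    using insert.prems(1)[of i] that unfolding quasi_geometric_def
    by (metis insertCI twist_commute twist_zero)
  ultimately have "(1 - \<alpha> j) ^ r * c = 0"
    using insert.IH[of "\<lambda>i. (twist (\<alpha> j) ^^ r) (s i)"] insert.prems(2) by blast
  then show ?case using insert.prems(2)[of j] by auto
qed

text \<open>The composite of the operators \<open>E - a\<close> is the polynomial with roots
  \<open>as\<close> evaluated at the shift \<open>E\<close>. This lets a factorized linear
  recurrence act factor by factor.\<close>

lemma foldr_twist:
  "foldr twist as s k = (\<Sum>j\<le>length as. coeff (\<Prod>a\<leftarrow>as. [:- a, 1:]) j * s (j + k))"
proof (induction as arbitrary: k)
  case (Cons a as)
  let ?q = "\<Prod>a\<leftarrow>as. [:- a, 1:]"
  have "degree ?q \<le> length as"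
  proof (induction as)
    case (Cons b as)
    have "degree ([:- b, 1:] * (\<Prod>a\<leftarrow>as. [:- a, 1:])) \<le>
        degree [:- b, 1:] + degree (\<Prod>a\<leftarrow>as. [:- a, 1:])"
      by (rule degree_mult_le)
    then show ?case using Cons.IH by simp
  qed simp
  then have 0: "coeff ?q (Suc (length as)) = 0" by (intro coeff_eq_0) simp
  \<comment> \<open>Split the factor \<open>X - a\<close>: multiplication by \<open>X\<close> is
    \<open>pCons 0\<close> and shifts the sequence, while in the other part the top index drops out
    because \<open>?q\<close> has degree at most \<open>length as\<close>.\<close>
  have "(\<Sum>j\<le>Suc (length as). coeff ([:- a, 1:] * ?q) j * s (j + k)) =
      (\<Sum>j\<le>Suc (length as). coeff (pCons 0 ?q) j * s (j + k))
      - a * (\<Sum>j\<le>Suc (length as). coeff ?q j * s (j + k))"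
    by (simp add: sum_subtractf[symmetric] sum_distrib_left algebra_simps del: sum.atMost_Suc)
  also have "(\<Sum>j\<le>Suc (length as). coeff (pCons 0 ?q) j * s (j + k)) =
      (\<Sum>j\<le>length as. coeff ?q j * s (j + Suc k))"
    by (subst sum.atMost_Suc_shift) simp
  also have "(\<Sum>j\<le>Suc (length as). coeff ?q j * s (j + k)) =
      (\<Sum>j\<le>length as. coeff ?q j * s (j + k))"
    using 0 by simp
  finally show ?case using Cons.IH[of k] Cons.IH[of "Suc k"] by (simp add: twist_def)
qed simp

section \<open>Annihilating polynomials and generalized eigenvectors\<close>

text \<open>A split monic polynomial in \<open>B\<close>, given by its list of roots and applied to
  \<open>x\<close>. The list form allows factors to be sorted by root.\<close>

definition char_op :: "'k::field mat \<Rightarrow> 'k list \<Rightarrow> 'k vec \<Rightarrow> 'k vec" where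
  "char_op B as x = foldr (\<lambda>a y. char_matrix B a *\<^sub>v y) as x"

lemma char_op_simps [simp]:
  "char_op B [] x = x" "char_op B (a # as) x = char_matrix B a *\<^sub>v char_op B as x"
  by (simp_all add: char_op_def)

context
  fixes B :: "'k::field mat" and n :: nat
  assumes B: "B \<in> carrier_mat n n"
begin

lemma char_matrix_mult_vec:
  assumes "y \<in> carrier_vec n"
  shows "char_matrix B a *\<^sub>v y = B *\<^sub>v y - a \<cdot>\<^sub>v y"
proof -
  have "char_matrix B a *\<^sub>v y = B *\<^sub>v y + (- a \<cdot>\<^sub>m 1\<^sub>m n) *\<^sub>v y"
    using B assms unfolding char_matrix_def by (subst add_mult_distrib_mat_vec[of _ n n]) auto
  also have "(- a \<cdot>\<^sub>m 1\<^sub>m n) *\<^sub>v y = - a \<cdot>\<^sub>v y"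
    using assms by (intro eq_vecI) auto
  finally show ?thesis using B assms by (auto intro!: eq_vecI)
qed

lemma char_op_closed: "x \<in> carrier_vec n \<Longrightarrow> char_op B as x \<in> carrier_vec n"
  using B by (induction as) (auto intro: mult_mat_vec_carrier[of _ n n])

lemma char_matrix_commute:
  assumes "y \<in> carrier_vec n"
  shows "char_matrix B a *\<^sub>v (char_matrix B b *\<^sub>v y) = char_matrix B b *\<^sub>v (char_matrix B a *\<^sub>v y)"
proof -
  have "char_matrix B a *\<^sub>v (char_matrix B b *\<^sub>v y) =
      B *\<^sub>v (B *\<^sub>v y) - b \<cdot>\<^sub>v (B *\<^sub>v y) - a \<cdot>\<^sub>v (B *\<^sub>v y - b \<cdot>\<^sub>v y)" for a b
  proof -
    have By: "B *\<^sub>v y \<in> carrier_vec n" "b \<cdot>\<^sub>v y \<in> carrier_vec n" using B assms by auto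
    have "char_matrix B a *\<^sub>v (char_matrix B b *\<^sub>v y) =
        B *\<^sub>v (B *\<^sub>v y - b \<cdot>\<^sub>v y) - a \<cdot>\<^sub>v (B *\<^sub>v y - b \<cdot>\<^sub>v y)"
      unfolding char_matrix_mult_vec[OF assms] using By by (intro char_matrix_mult_vec) auto
    also have "B *\<^sub>v (B *\<^sub>v y - b \<cdot>\<^sub>v y) = B *\<^sub>v (B *\<^sub>v y) - b \<cdot>\<^sub>v (B *\<^sub>v y)"
      unfolding mult_minus_distrib_mat_vec[OF B By] mult_mat_vec[OF B assms] ..
    finally show ?thesis .
  qed
  moreover have "B *\<^sub>v (B *\<^sub>v y) - b \<cdot>\<^sub>v (B *\<^sub>v y) - a \<cdot>\<^sub>v (B *\<^sub>v y - b \<cdot>\<^sub>v y) =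
      B *\<^sub>v (B *\<^sub>v y) - a \<cdot>\<^sub>v (B *\<^sub>v y) - b \<cdot>\<^sub>v (B *\<^sub>v y - a \<cdot>\<^sub>v y)"
    using B assms by (intro eq_vecI) (auto simp: algebra_simps)
  ultimately show ?thesis by simp
qed

lemma char_op_commute:
  assumes "x \<in> carrier_vec n"
  shows "char_matrix B a *\<^sub>v char_op B as x = char_op B as (char_matrix B a *\<^sub>v x)"
  using assms
proof (induction as)
  case (Cons b as)
  then show ?case
    using char_matrix_commute[OF char_op_closed[OF Cons.prems], of a b as] by simp
qed simp

text \<open>The factors \<open>B - a\<close> commute, so those with roots in \<open>P\<close> can be
  applied last.\<close>

lemma char_op_filter:
  assumes "x \<in> carrier_vec n"
  shows "char_op B as x = char_op B (filter P as) (char_op B (filter (\<lambda>a. \<not> P a) as) x)"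
proof (induction as)
  case (Cons a as)
  then have "char_op B (a # as) x =
      char_matrix B a *\<^sub>v char_op B (filter P as) (char_op B (filter (\<lambda>a. \<not> P a) as) x)"
    by simp
  then show ?case
    using char_op_commute[OF char_op_closed[OF assms], of a "filter P as"] by simp
qed simp

text \<open>Shifting the sequence of \<open>B ^ k\<close> applied to \<open>x\<close> amounts to
  replacing \<open>x\<close> by its image under \<open>B\<close>. This links sequences with
  generalized eigenvectors.\<close>

lemma twist_coordinates:
  assumes "x \<in> carrier_vec n" "i < n"
  shows "twist a (\<lambda>k. ((B ^\<^sub>m k) *\<^sub>v x) $ i) = (\<lambda>k. ((B ^\<^sub>m k) *\<^sub>v (char_matrix B a *\<^sub>v x)) $ i)"
proof
  fix k
  have Bk: "B ^\<^sub>m k \<in> carrier_mat n n" using B by (rule pow_carrier_mat)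
  have "(B ^\<^sub>m k) *\<^sub>v (char_matrix B a *\<^sub>v x) = (B ^\<^sub>m Suc k) *\<^sub>v x - a \<cdot>\<^sub>v ((B ^\<^sub>m k) *\<^sub>v x)"
    using Bk B assms(1)
    by (simp add: char_matrix_mult_vec mult_minus_distrib_mat_vec[of _ n n] mult_mat_vec[of _ n n]
        assoc_mult_mat_vec[of _ n n])
  then show "twist a (\<lambda>k. ((B ^\<^sub>m k) *\<^sub>v x) $ i) k = ((B ^\<^sub>m k) *\<^sub>v (char_matrix B a *\<^sub>v x)) $ i"
    using B Bk assms by (simp add: twist_def del: pow_mat.simps)
qed

lemma foldr_twist_coordinates:
  assumes "x \<in> carrier_vec n" "i < n"
  shows "foldr twist as (\<lambda>k. ((B ^\<^sub>m k) *\<^sub>v x) $ i) = (\<lambda>k. ((B ^\<^sub>m k) *\<^sub>v char_op B as x) $ i)"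
proof (induction as)
  case (Cons a as)
  then show ?case
    using twist_coordinates[OF char_op_closed[OF assms(1)] assms(2)] by simp
qed simp

lemma quasi_geometric_coordinates:
  assumes "x \<in> carrier_vec n" "i < n" "char_op B (replicate r a) x = 0\<^sub>v n"
  shows "quasi_geometric a (\<lambda>k. ((B ^\<^sub>m k) *\<^sub>v x) $ i)"
  unfolding quasi_geometric_def
proof (rule exI)
  have "B ^\<^sub>m k \<in> carrier_mat n n" for k using B by (rule pow_carrier_mat)
  then have "((B ^\<^sub>m k) *\<^sub>v 0\<^sub>v n) $ i = 0" for k
    using assms(2) by (metis carrier_matD index_mult_mat_vec row_carrier scalar_prod_right_zero)
  then have "foldr twist (replicate r a) (\<lambda>k. ((B ^\<^sub>m k) *\<^sub>v x) $ i) = (\<lambda>_. 0)"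
    unfolding foldr_twist_coordinates[OF assms(1,2)] assms(3) by (rule ext)
  then show "(twist a ^^ r) (\<lambda>k. ((B ^\<^sub>m k) *\<^sub>v x) $ i) = (\<lambda>_. 0)" by (simp add: foldr_replicate)
qed

end

section \<open>Annihilating polynomials and their linear factors\<close>

text \<open>The \<open>n + 1\<close> vectors \<open>x\<close>, \<open>B x\<close>, ...,
  \<open>B ^ n x\<close> live in dimension \<open>n\<close>. A zero row \<open>n\<close> makes their
  matrix square and singular, and \<open>c\<close> is a kernel vector.\<close>

lemma krylov_dependent:
  fixes B :: "'k::field mat"
  assumes B: "B \<in> carrier_mat n n" and x: "x \<in> carrier_vec n"
  shows "\<exists>c. c \<noteq> 0\<^sub>v (Suc n) \<and> c \<in> carrier_vec (Suc n) \<and>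
    (\<forall>i<n. (\<Sum>j\<le>n. c $ j * ((B ^\<^sub>m j) *\<^sub>v x) $ i) = 0)"
proof -
  define M where "M = mat (Suc n) (Suc n) (\<lambda>(i, j). if i < n then ((B ^\<^sub>m j) *\<^sub>v x) $ i else 0)"
  have M: "M \<in> carrier_mat (Suc n) (Suc n)" by (simp add: M_def)
  have "det M = 0"
    unfolding det_def'[OF M]
  proof (intro sum.neutral ballI)
    fix p assume "p \<in> {p. p permutes {0..<Suc n}}"
    then have "p n < Suc n" using permutes_in_image[of p "{0..<Suc n}" n] by auto
    then have "(\<Prod>i = 0..<Suc n. M $$ (i, p i)) = 0"
      by (intro prod_zero bexI[of _ n]) (auto simp: M_def)
    then show "signof p * (\<Prod>i = 0..<Suc n. M $$ (i, p i)) = 0" by simp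
  qed
  then obtain c where c: "c \<in> carrier_vec (Suc n)" "c \<noteq> 0\<^sub>v (Suc n)" "M *\<^sub>v c = 0\<^sub>v (Suc n)"
    using det_0_iff_vec_prod_zero_field[OF M] by blast
  have "(\<Sum>j\<le>n. c $ j * ((B ^\<^sub>m j) *\<^sub>v x) $ i) = 0" if "i < n" for i
  proof -
    have "(M *\<^sub>v c) $ i = (\<Sum>j\<le>n. c $ j * ((B ^\<^sub>m j) *\<^sub>v x) $ i)"
      using that c(1) by (simp add: M_def scalar_prod_def atLeast0LessThan lessThan_Suc_atMost mult.commute)
    then show ?thesis using c(3) that by simp
  qed
  then show ?thesis using c by blast
qed

text \<open>The linear relation among the iterates of \<open>x\<close> is a nonzero polynomial,
  which splits over an algebraically closed field; dividing by its leading coefficient leaves the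
  list of roots.\<close>

lemma char_op_annihilates:
  fixes B :: "'k::alg_closed_field mat"
  assumes B: "B \<in> carrier_mat n n" and x: "x \<in> carrier_vec n"
  shows "\<exists>as. char_op B as x = 0\<^sub>v n"
proof -
  obtain c where c: "c \<noteq> 0\<^sub>v (Suc n)" "c \<in> carrier_vec (Suc n)"
    "\<forall>i<n. (\<Sum>j\<le>n. c $ j * ((B ^\<^sub>m j) *\<^sub>v x) $ i) = 0"
    using krylov_dependent[OF B x] by blast
  define p where "p = (\<Sum>j\<le>n. monom (c $ j) j)"
  have coeff_p: "coeff p j = (if j \<le> n then c $ j else 0)" for j
    unfolding p_def coeff_sum by simp
  have "p \<noteq> 0"
  proof
    assume "p = 0"
    then have "c $ j = 0" if "j < Suc n" for j using coeff_p[of j] that by simp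
    then show False using c(1,2) by (auto intro!: eq_vecI)
  qed
  then obtain A where A: "size A = degree p" "p = smult (lead_coeff p) (\<Prod>a\<in>#A. [:- a, 1:])"
    using alg_closed_imp_factorization by blast
  obtain as where as: "A = mset as" using ex_mset[of A] by blast
  have "degree p \<le> n" using coeff_p by (intro degree_le) simp
  then have len: "length as \<le> n" using A(1) as by simp
  let ?q = "\<Prod>a\<leftarrow>as. [:- a, 1:]"
  have p: "p = smult (lead_coeff p) ?q" using A(2) unfolding as by (simp add: prod_mset_prod_list flip: mset_map)
  have deg: "degree ?q = length as"
    using A(1) p \<open>p \<noteq> 0\<close> unfolding as by (metis degree_smult_eq leading_coeff_0_iff size_mset)
  have "char_op B as x $ i = 0" if i: "i < n" for i
  proof -
    let ?s = "\<lambda>k. ((B ^\<^sub>m k) *\<^sub>v x) $ i"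
    \<comment> \<open>The relation, divided by the leading coefficient, is the twisted coordinate
      sequence at index \<open>0\<close>, where \<open>B ^ 0\<close> is the identity.\<close>
    have "0 = (\<Sum>j\<le>n. coeff p j * ?s j)" using c(3) i by (simp add: coeff_p)
    also have "\<dots> = lead_coeff p * (\<Sum>j\<le>n. coeff ?q j * ?s j)"
      by (subst p) (simp add: sum_distrib_left mult.assoc del: coeff_0_prod_list)
    also have "(\<Sum>j\<le>n. coeff ?q j * ?s j) = (\<Sum>j\<le>length as. coeff ?q j * ?s j)"
      using len by (intro sum.mono_neutral_right) (auto simp: coeff_eq_0 deg)
    also have "\<dots> = foldr twist as ?s 0" by (simp add: foldr_twist)
    also have "\<dots> = char_op B as x $ i"
      using char_op_closed[OF B x] B by (simp add: foldr_twist_coordinates[OF B x i])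
    finally show ?thesis using \<open>p \<noteq> 0\<close> by simp
  qed
  then have "char_op B as x = 0\<^sub>v n" using char_op_closed[OF B x, of as] by (intro eq_vecI) auto
  then show ?thesis ..
qed

text \<open>By \<open>adj\<close>, applying \<open>B - b\<close> multiplies the pairing with
  \<open>v\<close> by \<open>\<mu> - b\<close>. Applying to \<open>x\<close> the annihilating
  factors with roots other than \<open>\<mu>\<close> thus keeps the pairing nonzero, and powers of
  \<open>B - \<mu>\<close> kill the result. A genuine eigenvector may pair to zero with
  \<open>v\<close>, as a Jordan block shows.\<close>

lemma generalized_eigenvector_exists:
  fixes B :: "'k::alg_closed_field mat"
  assumes B: "B \<in> carrier_mat n n" and x: "x \<in> carrier_vec n" and v: "v \<in> carrier_vec n"
    and adj: "\<And>y. y \<in> carrier_vec n \<Longrightarrow> (B *\<^sub>v y) \<bullet> v = \<mu> * (y \<bullet> v)" and xv: "x \<bullet> v \<noteq> 0"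
  shows "\<exists>y r. y \<in> carrier_vec n \<and> y \<bullet> v \<noteq> 0 \<and> char_op B (replicate r \<mu>) y = 0\<^sub>v n"
proof -
  obtain as where as: "char_op B as x = 0\<^sub>v n" using char_op_annihilates[OF B x] by blast
  define y where "y = char_op B (filter (\<lambda>a. a \<noteq> \<mu>) as) x"
  have y: "y \<in> carrier_vec n" unfolding y_def by (rule char_op_closed[OF B x])
  have "char_op B (filter (\<lambda>a. a = \<mu>) as) y = 0\<^sub>v n"
    using char_op_filter[OF B x, of as "\<lambda>a. a = \<mu>"] as by (simp add: y_def)
  moreover have "filter (\<lambda>a. a = \<mu>) as = replicate (length (filter (\<lambda>a. a = \<mu>) as)) \<mu>"
    by (induction as) auto
  moreover have "y \<bullet> v \<noteq> 0"
  proof -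
    have "char_op B bs x \<bullet> v \<noteq> 0" if "\<mu> \<notin> set bs" for bs
      using that
    proof (induction bs)
      case Nil
      then show ?case using xv by simp
    next
      case (Cons b bs)
      let ?z = "char_op B bs x"
      have z: "?z \<in> carrier_vec n" by (rule char_op_closed[OF B x])
      have "char_op B (b # bs) x \<bullet> v = (B *\<^sub>v ?z - b \<cdot>\<^sub>v ?z) \<bullet> v"
        by (simp add: char_matrix_mult_vec[OF B z])
      also have "\<dots> = (\<mu> - b) * (?z \<bullet> v)"
        using B z v by (simp add: minus_scalar_prod_distrib[of _ n] adj algebra_simps)
      finally show ?case using Cons by simp
    qed
    then show ?thesis unfolding y_def by simp
  qed
  ultimately show ?thesis using y by metis
qed

text \<open>Each vector is killed by a product of factors \<open>A - a\<close>. Those with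
  \<open>a\<close> different from \<open>1\<close> are injective, so a power of \<open>A - 1\<close>
  alone already kills it.\<close>

lemma unipotent_if_eigenvalues_one:
  fixes A :: "'k::alg_closed_field mat"
  assumes A: "A \<in> carrier_mat n n" and ev: "\<And>a. eigenvalue A a \<Longrightarrow> a = 1"
  shows "unipotent_mat n A"
proof -
  let ?N = "A - 1\<^sub>m n"
  have N: "?N \<in> carrier_mat n n" by (rule minus_carrier_mat) simp
  have Npow: "?N ^\<^sub>m r \<in> carrier_mat n n" for r using N by (rule pow_carrier_mat)
  have N_eq: "?N = char_matrix A 1" using A by (auto simp: char_matrix_def intro!: eq_matI)
  have inj: "z = 0\<^sub>v n" if "char_op A bs z = 0\<^sub>v n" "1 \<notin> set bs" "z \<in> carrier_vec n" for bs z
    using that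
  proof (induction bs)
    case (Cons b bs)
    have "char_op A bs z \<in> carrier_vec n" using char_op_closed[OF A Cons.prems(3)] .
    then have "char_op A bs z = 0\<^sub>v n"
      using Cons.prems(1,2) ev[of b] eigenvalue_char_matrix[OF A, of b] by auto
    then show ?case using Cons by simp
  qed simp
  have op_pow: "char_op A (replicate r 1) z = (?N ^\<^sub>m r) *\<^sub>v z" if "z \<in> carrier_vec n" for r z
    using that
  proof (induction r arbitrary: z)
    case (Suc r)
    have "char_op A (replicate (Suc r) 1) z = char_op A (replicate r 1) (?N *\<^sub>v z)"
      using char_op_commute[OF A Suc.prems] by (simp add: N_eq)
    also have "\<dots> = (?N ^\<^sub>m r) *\<^sub>v (?N *\<^sub>v z)"
      using Suc.prems N by (intro Suc.IH) simp
    finally show ?case using Suc.prems N Npow[of r] by (simp add: assoc_mult_mat_vec[of _ n n])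
  qed simp
  have ex: "\<exists>r. char_op A (replicate r 1) z = 0\<^sub>v n" if z: "z \<in> carrier_vec n" for z
  proof -
    obtain as where as: "char_op A as z = 0\<^sub>v n" using char_op_annihilates[OF A z] by blast
    let ?y = "char_op A (filter (\<lambda>a. \<not> a \<noteq> 1) as) z"
    have "char_op A (filter (\<lambda>a. a \<noteq> 1) as) ?y = 0\<^sub>v n"
      using char_op_filter[OF A z, of as "\<lambda>a. a \<noteq> 1"] as by simp
    then have "?y = 0\<^sub>v n" by (rule inj) (use char_op_closed[OF A z] in auto)
    moreover have "filter (\<lambda>a. \<not> a \<noteq> 1) as = replicate (length (filter (\<lambda>a. \<not> a \<noteq> 1) as)) 1"
      by (induction as) auto
    ultimately show ?thesis by metis
  qed
  have mono: "char_op A (replicate (q + r) 1) z = 0\<^sub>v n"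
    if "char_op A (replicate r 1) z = 0\<^sub>v n" for q r z
  proof (induction q)
    case (Suc q)
    have "char_matrix A 1 *\<^sub>v 0\<^sub>v n = 0\<^sub>v n"
      using char_matrix_closed[OF A, of 1] by (intro eq_vecI) auto
    then show ?case using Suc by simp
  qed (use that in simp)
  have "\<forall>i. \<exists>r. char_op A (replicate r 1) (unit_vec n i) = 0\<^sub>v n"
    by (intro allI ex unit_vec_carrier)
  then obtain r where r: "\<And>i. char_op A (replicate (r i) 1) (unit_vec n i) = 0\<^sub>v n"
    by metis
  \<comment> \<open>\<open>R\<close> is an exponent that works for all unit vectors at once.\<close>
  define R where "R = (\<Sum>i<n. r i)"
  have "(?N ^\<^sub>m R) $$ (j, i) = 0" if i: "i < n" and j: "j < n" for i j
  proof -
    have "r i \<le> R" unfolding R_def using i by (intro member_le_sum) auto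
    then have "char_op A (replicate R 1) (unit_vec n i) = 0\<^sub>v n"
      using mono[OF r[of i], of "R - r i"] by simp
    then have "(?N ^\<^sub>m R) *\<^sub>v unit_vec n i = 0\<^sub>v n" using op_pow[of "unit_vec n i" R] by simp
    then have "((?N ^\<^sub>m R) *\<^sub>v unit_vec n i) $ j = 0" using j by simp
    then show ?thesis using Npow[of R] i j by simp
  qed
  then have "?N ^\<^sub>m R = 0\<^sub>m n n"
    using Npow[of R] by (intro eq_matI) auto
  then show ?thesis using A unfolding unipotent_mat_def by blast
qed

section \<open>Tensor powers\<close>

text \<open>Kronecker product. With \<open>q\<close> the size of the second factor, the pair of
  indices \<open>a\<close>, \<open>b\<close> is encoded as \<open>a * q + b\<close> and recovered by
  \<open>div\<close> and \<open>mod\<close>.\<close>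

definition kron :: "'k::comm_ring_1 mat \<Rightarrow> 'k mat \<Rightarrow> 'k mat" where
  "kron A B = mat (dim_row A * dim_row B) (dim_col A * dim_col B)
    (\<lambda>(i, j). A $$ (i div dim_row B, j div dim_col B) * B $$ (i mod dim_row B, j mod dim_col B))"

definition kron_vec :: "'k::comm_ring_1 vec \<Rightarrow> 'k vec \<Rightarrow> 'k vec" where
  "kron_vec u w = vec (dim_vec u * dim_vec w) (\<lambda>i. u $ (i div dim_vec w) * w $ (i mod dim_vec w))"

fun tensor_power :: "nat \<Rightarrow> 'k::comm_ring_1 mat \<Rightarrow> 'k mat" where
  "tensor_power 0 A = 1\<^sub>m 1"
| "tensor_power (Suc d) A = kron (tensor_power d A) A"

fun tensor_power_vec :: "nat \<Rightarrow> 'k::comm_ring_1 vec \<Rightarrow> 'k vec" where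
  "tensor_power_vec 0 v = vec 1 (\<lambda>_. 1)"
| "tensor_power_vec (Suc d) v = kron_vec (tensor_power_vec d v) v"

lemma div_less_mod_less:
  assumes "(i::nat) < p * q"
  shows "i div q < p" "i mod q < q"
  using assms by (auto simp: less_mult_imp_div_less) (metis mod_less_divisor mult_0_right not_less_zero gr_zeroI)

lemma sum_div_mod:
  fixes f :: "nat \<Rightarrow> nat \<Rightarrow> 'a::comm_monoid_add"
  shows "(\<Sum>i = 0..<p * q. f (i div q) (i mod q)) = (\<Sum>a = 0..<p. \<Sum>b = 0..<q. f a b)"
proof (induction p)
  case (Suc p)
  have "(\<Sum>i = 0..<Suc p * q. f (i div q) (i mod q)) =
      (\<Sum>i = 0..<p * q. f (i div q) (i mod q)) + (\<Sum>i = p * q..<p * q + q. f (i div q) (i mod q))"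
    by (simp add: sum.atLeastLessThan_concat add.commute)
  also have "(\<Sum>i = p * q..<p * q + q. f (i div q) (i mod q)) = (\<Sum>b = 0..<q. f p b)"
    using sum.shift_bounds_nat_ivl[of "\<lambda>i. f (i div q) (i mod q)" 0 "p * q" q]
    by (simp add: add.commute)
  finally show ?case using Suc by simp
qed simp

lemma kron_carrier: "A \<in> carrier_mat p p \<Longrightarrow> B \<in> carrier_mat q q \<Longrightarrow> kron A B \<in> carrier_mat (p * q) (p * q)"
  by (auto simp: kron_def)

lemma kron_vec_carrier: "u \<in> carrier_vec p \<Longrightarrow> w \<in> carrier_vec q \<Longrightarrow> kron_vec u w \<in> carrier_vec (p * q)"
  by (auto simp: kron_vec_def)

lemma kron_mult:
  assumes A: "A \<in> carrier_mat p p" "C \<in> carrier_mat p p" and B: "B \<in> carrier_mat q q" "D \<in> carrier_mat q q"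
  shows "kron A B * kron C D = kron (A * C) (B * D)"
proof (rule eq_matI)
  fix i j assume "i < dim_row (kron (A * C) (B * D))" "j < dim_col (kron (A * C) (B * D))"
  then have ij: "i < p * q" "j < p * q" using assms by (auto simp: kron_def)
  note ij' = div_less_mod_less[OF ij(1)] div_less_mod_less[OF ij(2)]
  have "(kron A B * kron C D) $$ (i, j) =
      (\<Sum>l = 0..<p * q. A $$ (i div q, l div q) * B $$ (i mod q, l mod q) *
        (C $$ (l div q, j div q) * D $$ (l mod q, j mod q)))"
    using ij assms by (simp add: scalar_prod_def kron_def)
  also have "\<dots> = (\<Sum>a = 0..<p. \<Sum>b = 0..<q. A $$ (i div q, a) * B $$ (i mod q, b) *
        (C $$ (a, j div q) * D $$ (b, j mod q)))"
    by (rule sum_div_mod)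
  also have "\<dots> = (\<Sum>a = 0..<p. A $$ (i div q, a) * C $$ (a, j div q)) *
      (\<Sum>b = 0..<q. B $$ (i mod q, b) * D $$ (b, j mod q))"
    unfolding sum_product by (intro sum.cong) (auto simp: algebra_simps)
  also have "\<dots> = kron (A * C) (B * D) $$ (i, j)"
    using ij ij' assms by (simp add: scalar_prod_def kron_def)
  finally show "(kron A B * kron C D) $$ (i, j) = kron (A * C) (B * D) $$ (i, j)" .
qed (use assms in \<open>auto simp: kron_def\<close>)

lemma kron_mult_vec:
  assumes A: "A \<in> carrier_mat p p" "u \<in> carrier_vec p" and B: "B \<in> carrier_mat q q" "w \<in> carrier_vec q"
  shows "kron A B *\<^sub>v kron_vec u w = kron_vec (A *\<^sub>v u) (B *\<^sub>v w)"
proof (rule eq_vecI)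
  fix i assume "i < dim_vec (kron_vec (A *\<^sub>v u) (B *\<^sub>v w))"
  then have i: "i < p * q" using assms by (auto simp: kron_vec_def)
  note i' = div_less_mod_less[OF i]
  have "(kron A B *\<^sub>v kron_vec u w) $ i =
      (\<Sum>l = 0..<p * q. A $$ (i div q, l div q) * B $$ (i mod q, l mod q) *
        (u $ (l div q) * w $ (l mod q)))"
    using i assms by (simp add: scalar_prod_def kron_def kron_vec_def)
  also have "\<dots> = (\<Sum>a = 0..<p. \<Sum>b = 0..<q. A $$ (i div q, a) * B $$ (i mod q, b) *
        (u $ a * w $ b))"
    by (rule sum_div_mod)
  also have "\<dots> = (\<Sum>a = 0..<p. A $$ (i div q, a) * u $ a) * (\<Sum>b = 0..<q. B $$ (i mod q, b) * w $ b)"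
    unfolding sum_product by (intro sum.cong) (auto simp: algebra_simps)
  also have "\<dots> = kron_vec (A *\<^sub>v u) (B *\<^sub>v w) $ i"
    using i i' assms by (simp add: scalar_prod_def kron_vec_def)
  finally show "(kron A B *\<^sub>v kron_vec u w) $ i = kron_vec (A *\<^sub>v u) (B *\<^sub>v w) $ i" .
qed (use assms in \<open>auto simp: kron_def kron_vec_def\<close>)

lemma kron_vec_scalar_prod:
  assumes "u \<in> carrier_vec p" "u' \<in> carrier_vec p" "w \<in> carrier_vec q" "w' \<in> carrier_vec q"
  shows "kron_vec u w \<bullet> kron_vec u' w' = (u \<bullet> u') * (w \<bullet> w')"
proof -
  have "kron_vec u w \<bullet> kron_vec u' w' =
      (\<Sum>l = 0..<p * q. u $ (l div q) * w $ (l mod q) * (u' $ (l div q) * w' $ (l mod q)))"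
    using assms by (simp add: scalar_prod_def kron_vec_def)
  also have "\<dots> = (\<Sum>a = 0..<p. \<Sum>b = 0..<q. u $ a * w $ b * (u' $ a * w' $ b))"
    by (rule sum_div_mod)
  also have "\<dots> = (u \<bullet> u') * (w \<bullet> w')"
    using assms unfolding scalar_prod_def sum_product
    by (auto intro!: sum.cong simp: algebra_simps)
  finally show ?thesis .
qed

lemma kron_transpose: "(kron A B)\<^sup>T = kron A\<^sup>T B\<^sup>T"
  if "A \<in> carrier_mat p p" "B \<in> carrier_mat q q"
proof (rule eq_matI)
  fix i j assume "i < dim_row (kron A\<^sup>T B\<^sup>T)" "j < dim_col (kron A\<^sup>T B\<^sup>T)"
  then have ij: "i < p * q" "j < p * q" using that by (auto simp: kron_def)
  then show "(kron A B)\<^sup>T $$ (i, j) = kron A\<^sup>T B\<^sup>T $$ (i, j)"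
    using that div_less_mod_less[OF ij(1)] div_less_mod_less[OF ij(2)] by (simp add: kron_def)
qed (use that in \<open>auto simp: kron_def\<close>)

lemma kron_one: "kron (1\<^sub>m p) (1\<^sub>m q) = 1\<^sub>m (p * q)"
proof (rule eq_matI)
  fix i j assume "i < dim_row (1\<^sub>m (p * q))" "j < dim_col (1\<^sub>m (p * q))"
  then have ij: "i < p * q" "j < p * q" by auto
  have "i = j \<longleftrightarrow> i div q = j div q \<and> i mod q = j mod q" by (metis div_mult_mod_eq)
  then show "kron (1\<^sub>m p) (1\<^sub>m q) $$ (i, j) = 1\<^sub>m (p * q) $$ (i, j)"
    using ij div_less_mod_less[OF ij(1)] div_less_mod_less[OF ij(2)] by (simp add: kron_def)
qed (auto simp: kron_def)

lemma tensor_power_carrier: "A \<in> carrier_mat n n \<Longrightarrow> tensor_power d A \<in> carrier_mat (n ^ d) (n ^ d)"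
  by (induction d) (auto intro: kron_carrier simp: mult.commute[of n])

lemma tensor_power_vec_carrier: "v \<in> carrier_vec n \<Longrightarrow> tensor_power_vec d v \<in> carrier_vec (n ^ d)"
  by (induction d) (auto intro: kron_vec_carrier simp: mult.commute[of n])

lemma tensor_power_mult:
  assumes "A \<in> carrier_mat n n" "B \<in> carrier_mat n n"
  shows "tensor_power d A * tensor_power d B = tensor_power d (A * B)"
proof (induction d)
  case (Suc d)
  then show ?case
    using kron_mult[OF tensor_power_carrier[OF assms(1)] tensor_power_carrier[OF assms(2)] assms]
    by simp
qed simp

lemma tensor_power_one: "tensor_power d (1\<^sub>m n) = 1\<^sub>m (n ^ d)"
  by (induction d) (auto simp: kron_one mult.commute[of n])

lemma tensor_power_pow:
  assumes "A \<in> carrier_mat n n"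
  shows "tensor_power d A ^\<^sub>m k = tensor_power d (A ^\<^sub>m k)"
proof (induction k)
  case 0
  have "dim_row (tensor_power d A) = n ^ d" using tensor_power_carrier[OF assms, of d] by simp
  then show ?case using assms by (simp add: tensor_power_one)
next
  case (Suc k)
  then show ?case using tensor_power_mult[OF pow_carrier_mat[OF assms] assms] by simp
qed

lemma tensor_power_transpose: "A \<in> carrier_mat n n \<Longrightarrow> (tensor_power d A)\<^sup>T = tensor_power d A\<^sup>T"
  by (induction d) (auto simp: kron_transpose[OF tensor_power_carrier])

lemma tensor_power_mult_vec:
  assumes "A \<in> carrier_mat n n" "v \<in> carrier_vec n"
  shows "tensor_power d A *\<^sub>v tensor_power_vec d v = tensor_power_vec d (A *\<^sub>v v)"
proof (induction d)
  case (Suc d)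
  then show ?case
    using kron_mult_vec[OF tensor_power_carrier[OF assms(1)] tensor_power_vec_carrier[OF assms(2)] assms]
    by simp
qed simp

lemma tensor_power_vec_scalar_prod:
  assumes "u \<in> carrier_vec n" "v \<in> carrier_vec n"
  shows "tensor_power_vec d u \<bullet> tensor_power_vec d v = (u \<bullet> v) ^ d"
proof (induction d)
  case (Suc d)
  then show ?case
    using kron_vec_scalar_prod[OF tensor_power_vec_carrier[OF assms(1)]
        tensor_power_vec_carrier[OF assms(2)] assms] by (simp add: mult.commute)
qed (simp add: scalar_prod_def)

lemma tensor_power_vec_Suc_index:
  assumes "v \<in> carrier_vec n" "i < n ^ Suc d"
  shows "tensor_power_vec (Suc d) v $ i = tensor_power_vec d v $ (i div n) * v $ (i mod n)"
    "i div n < n ^ d" "i mod n < n"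
proof -
  have i: "i < n ^ d * n" using assms(2) by (simp add: mult.commute)
  show "i div n < n ^ d" "i mod n < n" using div_less_mod_less[OF i] .
  show "tensor_power_vec (Suc d) v $ i = tensor_power_vec d v $ (i div n) * v $ (i mod n)"
    using assms i tensor_power_vec_carrier[OF assms(1), of d] by (simp add: kron_vec_def)
qed

lemma tensor_power_Suc_index:
  assumes "A \<in> carrier_mat n n" "i < n ^ Suc d" "j < n ^ Suc d"
  shows "tensor_power (Suc d) A $$ (i, j) = tensor_power d A $$ (i div n, j div n) * A $$ (i mod n, j mod n)"
proof -
  have i: "i < n ^ d * n" "j < n ^ d * n" using assms by (simp_all add: mult.commute)
  then show ?thesis
    using assms i tensor_power_carrier[OF assms(1), of d] by (simp add: kron_def)
qed

lemma polyfun_tensor_power_vec: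
  assumes "{..<n} \<subseteq> X" "i < n ^ d"
  shows "polyfun X (\<lambda>a :: nat \<Rightarrow> 'k::comm_ring_1. tensor_power_vec d (vec n a) $ i)"
  using assms(2)
proof (induction d arbitrary: i)
  case (Suc d)
  have "polyfun X (\<lambda>a :: nat \<Rightarrow> 'k. tensor_power_vec d (vec n a) $ (i div n) * a (i mod n))"
    using tensor_power_vec_Suc_index(2,3)[OF vec_carrier Suc.prems] assms(1)
    by (intro polyfun_mult Suc.IH polyfun_var) auto
  moreover have "tensor_power_vec (Suc d) (vec n a) $ i = tensor_power_vec d (vec n a) $ (i div n) * a (i mod n)"
    for a :: "nat \<Rightarrow> 'k"
    using tensor_power_vec_Suc_index[OF _ Suc.prems, of "vec n a"] by simp
  ultimately show ?case by (simp only:)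
qed (simp add: polyfun_const)

text \<open>Each coordinate of the tensor power is a product of \<open>d\<close> coordinates of
  \<open>u k\<close>, and ratios multiply.\<close>

lemma quasi_geometric_tensor_power_vec:
  assumes "\<And>k. u k \<in> carrier_vec n" "\<And>i. i < n \<Longrightarrow> quasi_geometric \<mu> (\<lambda>k. u k $ i)" "i < n ^ d"
  shows "quasi_geometric (\<mu> ^ d) (\<lambda>k. tensor_power_vec d (u k) $ i)"
  using assms(3)
proof (induction d arbitrary: i)
  case (Suc d)
  have "quasi_geometric (\<mu> ^ d * \<mu>) (\<lambda>k. tensor_power_vec d (u k) $ (i div n) * u k $ (i mod n))"
    using tensor_power_vec_Suc_index(2,3)[OF assms(1) Suc.prems]
    by (intro quasi_geometric_mult Suc.IH assms(2)) auto
  then show ?case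
    using tensor_power_vec_Suc_index(1)[OF assms(1) Suc.prems] by (simp only: power_Suc mult.commute)
qed (simp add: quasi_geometric_one)

section \<open>The test module\<close>

lemma regular_on_polyfun:
  fixes f :: "(nat \<times> nat \<Rightarrow> 'k::field) \<Rightarrow> 'k"
  assumes "polyfun (mat_vars n) f" "\<And>A. A \<in> G \<Longrightarrow> h A = f (($$) A) / det A ^ e"
  shows "regular_on n G h"
proof -
  obtain p where "p \<in> polys_in (mat_vars n)" "\<forall>a. eval_mpol a p = f a"
    using assms(1) unfolding polyfun_def by (elim bexE)
  then show ?thesis
    unfolding regular_on_def eval_mat_def using assms(2) by (intro bexI[of _ p] exI[of _ e]) auto
qed

lemma regular_on_mult:
  assumes "regular_on n G f" "regular_on n G h"
  shows "regular_on n G (\<lambda>A. f A * h A)"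
proof -
  obtain p e q e' where "p \<in> polys_in (mat_vars n)" "\<forall>A\<in>G. f A = eval_mat A p / det A ^ e"
    "q \<in> polys_in (mat_vars n)" "\<forall>A\<in>G. h A = eval_mat A q / det A ^ e'"
    using assms unfolding regular_on_def by blast
  then show ?thesis
    unfolding regular_on_def
    by (intro bexI[of _ "p * q"] exI[of _ "e + e'"])
      (auto simp: polys_in_mult eval_mat_def eval_mpol_mult power_add)
qed

text \<open>Cramer's rule, from computing \<open>inv A * (A * adj_mat A)\<close> in two ways. It
  makes the entries of the inverse regular functions.\<close>

lemma inv_GL_eq_adj:
  assumes A: "A \<in> carrier (GL n)"
  shows "inv\<^bsub>GL n\<^esub> A = inverse (det A) \<cdot>\<^sub>m adj_mat A"
proof -
  note c = carrier_GL_mat[OF A] inv_GL[OF A]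
  note adj = adj_mat[OF c(1)]
  have "inv\<^bsub>GL n\<^esub> A * (A * adj_mat A) = adj_mat A"
    using adj(1) c by (simp add: assoc_mult_mat[of _ n n _ n _ n, symmetric])
  moreover have "inv\<^bsub>GL n\<^esub> A * (A * adj_mat A) = det A \<cdot>\<^sub>m inv\<^bsub>GL n\<^esub> A"
    using c(3) by (simp add: adj(2) mult_smult_distrib[of _ n n _ n])
  ultimately have "adj_mat A = det A \<cdot>\<^sub>m inv\<^bsub>GL n\<^esub> A" by simp
  then show ?thesis using det_GL[OF A] c(3) by (intro eq_matI) auto
qed

lemma regular_on_inv_entry:
  fixes G :: "'k::field mat set"
  assumes "G \<subseteq> carrier (GL n)" "i < n" "j < n"
  shows "regular_on n G (\<lambda>A. (inv\<^bsub>GL n\<^esub> A) $$ (i, j))"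
proof (rule regular_on_polyfun[where e = 1])
  \<comment> \<open>\<open>?h\<close> lists the entries left after deleting row \<open>j\<close> and
    column \<open>i\<close>; the indices are swapped because the adjugate is the transposed cofactor
    matrix.\<close>
  let ?h = "\<lambda>kl a. a (if fst kl < j then fst kl else Suc (fst kl), if snd kl < i then snd kl else Suc (snd kl))"
  let ?f = "\<lambda>a :: nat \<times> nat \<Rightarrow> 'k. (- 1) ^ (j + i) * det (mat (n - 1) (n - 1) (\<lambda>kl. ?h kl a))"
  show "polyfun (mat_vars n) ?f"
    by (intro polyfun_mult polyfun_const polyfun_det polyfun_var) auto
  fix A assume "A \<in> G"
  then have A: "A \<in> carrier (GL n)" using assms(1) by blast
  then have "A \<in> carrier_mat n n" by (rule carrier_GL_mat)
  then have "mat_delete A j i = mat (n - 1) (n - 1) (\<lambda>kl. ?h kl (($$) A))"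
    by (auto simp: mat_delete_def intro!: eq_matI)
  then show "(inv\<^bsub>GL n\<^esub> A) $$ (i, j) = ?f (($$) A) / det A ^ 1"
    using \<open>A \<in> carrier_mat n n\<close> assms(2,3)
    by (simp add: inv_GL_eq_adj[OF A] adj_mat_def cofactor_def field_simps)
qed

text \<open>The action on the dual of the natural module, in the dual basis; evaluation of a
  functional at a vector becomes the scalar product.\<close>

definition contragredient :: "nat \<Rightarrow> 'k::field mat \<Rightarrow> 'k mat" where
  "contragredient n A = (inv\<^bsub>GL n\<^esub> A)\<^sup>T"

text \<open>The module \<open>V \<oplus> (V\<^sup>*)\<^bsup>\<otimes>d\<^esup>\<close> with \<open>V\<close> the natural module.\<close>

definition test_rep :: "nat \<Rightarrow> nat \<Rightarrow> 'k::field mat \<Rightarrow> 'k mat" where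
  "test_rep n d A = four_block_mat A (0\<^sub>m n (n ^ d)) (0\<^sub>m (n ^ d) n) (tensor_power d (contragredient n A))"

lemma contragredient_carrier: "A \<in> carrier (GL n) \<Longrightarrow> contragredient n A \<in> carrier_mat n n"
  using inv_GL(2)[of A n] by (simp add: contragredient_def)

lemma contragredient_mult:
  assumes A: "A \<in> carrier (GL n)" and B: "B \<in> carrier (GL n)"
  shows "contragredient n (A * B) = contragredient n A * contragredient n B"
proof -
  have "inv\<^bsub>GL n\<^esub> (A * B) = inv\<^bsub>GL n\<^esub> B * inv\<^bsub>GL n\<^esub> A"
    using group.inv_mult_group[OF group_GL A B] by simp
  then show ?thesis
    unfolding contragredient_def using transpose_mult[OF inv_GL(2)[OF B] inv_GL(2)[OF A]] by simp
qed

lemma contragredient_one: "contragredient n (1\<^sub>m n :: 'k::field mat) = 1\<^sub>m n"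
proof -
  have "inv\<^bsub>GL n\<^esub> (1\<^sub>m n :: 'k mat) = 1\<^sub>m n"
    using monoid.inv_one[OF group.is_monoid[OF group_GL[of n, where 'k = 'k]]] by simp
  then show ?thesis unfolding contragredient_def by simp
qed

lemma test_rep_carrier:
  "A \<in> carrier (GL n) \<Longrightarrow> test_rep n d A \<in> carrier_mat (n + n ^ d) (n + n ^ d)"
  unfolding test_rep_def
  by (intro four_block_carrier_mat carrier_GL_mat tensor_power_carrier contragredient_carrier)

lemma test_rep_mult:
  assumes A: "A \<in> carrier (GL n)" and B: "B \<in> carrier (GL n)"
  shows "test_rep n d (A * B) = test_rep n d A * test_rep n d B"
proof -
  note c = carrier_GL_mat[OF A] carrier_GL_mat[OF B]
  note t = tensor_power_carrier[OF contragredient_carrier[OF A], of d]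
    tensor_power_carrier[OF contragredient_carrier[OF B], of d]
  show ?thesis
    unfolding test_rep_def contragredient_mult[OF A B]
    by (subst mult_four_block_mat[OF c(1) _ _ t(1) c(2) _ _ t(2)])
      (use c t mult_carrier_mat[OF t] in
        \<open>auto simp: tensor_power_mult[OF contragredient_carrier[OF A] contragredient_carrier[OF B]]\<close>)
qed

lemma test_rep_one: "test_rep n d (1\<^sub>m n) = 1\<^sub>m (n + n ^ d)"
  by (simp add: test_rep_def contragredient_one tensor_power_one)

lemma test_rep_GL:
  fixes A :: "'k::field mat"
  assumes A: "A \<in> carrier (GL n)"
  shows "test_rep n d A \<in> carrier (GL (n + n ^ d))"
proof -
  note i = inv_GL[OF A]
  have "test_rep n d (inv\<^bsub>GL n\<^esub> A) * test_rep n d A = 1\<^sub>m (n + n ^ d)"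
    "test_rep n d A * test_rep n d (inv\<^bsub>GL n\<^esub> A) = 1\<^sub>m (n + n ^ d)"
    using test_rep_mult[OF i(1) A, of d] test_rep_mult[OF A i(1), of d] i(3,4) test_rep_one
    by metis+
  then show ?thesis
    unfolding carrier_GL using test_rep_carrier[OF A] test_rep_carrier[OF i(1)] by blast
qed

lemma regular_on_tensor_power_entry:
  fixes \<psi> :: "'k::field mat \<Rightarrow> 'k mat"
  assumes "\<And>A. A \<in> G \<Longrightarrow> \<psi> A \<in> carrier_mat n n"
    and "\<And>i j. i < n \<Longrightarrow> j < n \<Longrightarrow> regular_on n G (\<lambda>A. \<psi> A $$ (i, j))"
    and "i < n ^ d" "j < n ^ d"
  shows "regular_on n G (\<lambda>A. tensor_power d (\<psi> A) $$ (i, j))"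
  using assms(3,4)
proof (induction d arbitrary: i j)
  case 0
  then show ?case by (intro regular_on_polyfun[OF polyfun_const[of _ 1], of _ _ 0]) auto
next
  case (Suc d)
  have ij: "i div n < n ^ d" "i mod n < n" "j div n < n ^ d" "j mod n < n"
    using div_less_mod_less[of i "n ^ d" n] div_less_mod_less[of j "n ^ d" n] Suc.prems
    by (simp_all add: mult.commute)
  have "regular_on n G (\<lambda>A. tensor_power d (\<psi> A) $$ (i div n, j div n) * \<psi> A $$ (i mod n, j mod n))"
    by (intro regular_on_mult Suc.IH assms(2) ij)
  then show ?case
    unfolding regular_on_def by (simp add: tensor_power_Suc_index[OF assms(1) Suc.prems] del: tensor_power.simps)
qed

lemma G_module_test_rep:
  fixes G :: "'k::field mat set"
  assumes "subgroup G (GL n)"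
  shows "G_module n G (n + n ^ d) (test_rep n d)"
  unfolding G_module_def
proof (intro conjI allI impI)
  have G: "G \<subseteq> carrier (GL n)" using assms by (rule subgroup.subset)
  show "test_rep n d \<in> hom (GL n\<lparr>carrier := G\<rparr>) (GL (n + n ^ d))"
    using G test_rep_GL test_rep_mult by (fastforce simp: hom_def)
  fix i j assume ij: "i < n + n ^ d" "j < n + n ^ d"
  have entry: "test_rep n d A $$ (i, j) =
      (if i < n then if j < n then A $$ (i, j) else 0
       else if j < n then 0 else tensor_power d (contragredient n A) $$ (i - n, j - n))"
    if "A \<in> G" for A
    unfolding test_rep_def
    using ij carrier_GL_mat[of A n] that G tensor_power_carrier[OF contragredient_carrier[of A n], of d]
    by (subst index_mat_four_block) auto
  have contr: "regular_on n G (\<lambda>A. contragredient n A $$ (k, l))" if kl: "k < n" "l < n" for k l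
  proof -
    have "contragredient n A $$ (k, l) = (inv\<^bsub>GL n\<^esub> A) $$ (l, k)" if "A \<in> G" for A
      using inv_GL(2)[of A n] G that kl by (auto simp: contragredient_def)
    then show ?thesis
      using regular_on_inv_entry[OF G kl(2,1)] unfolding regular_on_def by simp
  qed
  consider "i < n" "j < n" | "i < n \<longleftrightarrow> \<not> j < n" | "\<not> i < n" "\<not> j < n" by blast
  then show "regular_on n G (\<lambda>A. test_rep n d A $$ (i, j))"
  proof cases
    case 1
    then show ?thesis
      by (intro regular_on_polyfun[OF polyfun_var[of "(i, j)"], of _ _ _ 0]) (auto simp: entry)
  next
    case 2
    then show ?thesis
      by (intro regular_on_polyfun[OF polyfun_const[of _ 0], of _ _ 0]) (auto simp: entry)
  next
    case 3
    have "regular_on n G (\<lambda>A. tensor_power d (contragredient n A) $$ (i - n, j - n))"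
      using 3 ij contragredient_carrier G by (intro regular_on_tensor_power_entry contr) auto
    then show ?thesis using 3 entry unfolding regular_on_def by simp
  qed
qed

text \<open>The invariant is the pairing of \<open>\<phi>\<close> with the tensor power of
  \<open>u\<close>: linear in \<open>\<phi>\<close> and of degree \<open>d\<close> in
  \<open>u\<close>. Linearity in \<open>\<phi>\<close> makes the constant term vanish.\<close>

lemma evaluation_invariant:
  fixes G :: "'k::field mat set"
  assumes "subgroup G (GL n)"
  shows "\<exists>f \<in> plus_part (invariants n G (n + n ^ d) (test_rep n d)).
    \<forall>u \<in> carrier_vec n. \<forall>\<phi> \<in> carrier_vec (n ^ d). eval_vec (u @\<^sub>v \<phi>) f = \<phi> \<bullet> tensor_power_vec d u"
proof -
  let ?m = "n + n ^ d"
  have G: "G \<subseteq> carrier (GL n)" using assms by (rule subgroup.subset)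
  define F :: "(nat \<Rightarrow> 'k) \<Rightarrow> 'k" where
    "F a = (\<Sum>i = 0..<n ^ d. a (n + i) * tensor_power_vec d (vec n a) $ i)" for a
  have "polyfun {..<?m} F"
    unfolding F_def
    by (intro polyfun_sum polyfun_mult polyfun_var polyfun_tensor_power_vec) auto
  then obtain f where f: "f \<in> polys_in {..<?m}" "\<forall>a. eval_mpol a f = F a"
    unfolding polyfun_def by (elim bexE)
  have eval: "eval_vec (u @\<^sub>v \<phi>) f = \<phi> \<bullet> tensor_power_vec d u"
    if u: "u \<in> carrier_vec n" and \<phi>: "\<phi> \<in> carrier_vec (n ^ d)" for u \<phi>
  proof -
    have "vec n (($) (u @\<^sub>v \<phi>)) = u" using u \<phi> by (intro eq_vecI) auto
    then show ?thesis
      using u \<phi> tensor_power_vec_carrier[OF u, of d]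
      by (auto simp: eval_vec_def f(2) F_def scalar_prod_def intro!: sum.cong)
  qed
  have "const_term f = 0" by (simp add: const_term_eq_eval_zero f(2) F_def)
  moreover have "eval_vec (test_rep n d (inv\<^bsub>GL n\<^esub> g) *\<^sub>v w) f = eval_vec w f"
    if gG: "g \<in> G" and w: "w \<in> carrier_vec ?m" for g w
  proof -
    have g: "g \<in> carrier (GL n)" using gG G by blast
    define u where "u = vec_first w n"
    define \<phi> where "\<phi> = vec_last w (n ^ d)"
    have w_eq: "w = u @\<^sub>v \<phi>" using w by (simp add: u_def \<phi>_def)
    have c: "u \<in> carrier_vec n" "\<phi> \<in> carrier_vec (n ^ d)" by (simp_all add: u_def \<phi>_def)
    have gc: "g \<in> carrier_mat n n" using carrier_GL_mat[OF g] .
    have inv_u: "inv\<^bsub>GL n\<^esub> g *\<^sub>v u \<in> carrier_vec n" using inv_GL(2)[OF g] c(1) by simp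
    \<comment> \<open>So the inverse of \<open>g\<close> acts on functionals by a transpose, which
      moves across the scalar product and cancels the inverse acting on \<open>u\<close>.\<close>
    have contr: "contragredient n (inv\<^bsub>GL n\<^esub> g) = g\<^sup>T"
      unfolding contragredient_def using group.inv_inv[OF group_GL g] by simp
    have T: "tensor_power d g \<in> carrier_mat (n ^ d) (n ^ d)" using tensor_power_carrier[OF gc] .
    have T': "tensor_power d g\<^sup>T \<in> carrier_mat (n ^ d) (n ^ d)"
      using tensor_power_carrier[of "g\<^sup>T" n] gc by simp
    have "test_rep n d (inv\<^bsub>GL n\<^esub> g) *\<^sub>v w = (inv\<^bsub>GL n\<^esub> g *\<^sub>v u) @\<^sub>v (tensor_power d g\<^sup>T *\<^sub>v \<phi>)"
      unfolding test_rep_def contr w_eq by (rule mult_mat_vec_split[OF inv_GL(2)[OF g] T' c])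
    then have "eval_vec (test_rep n d (inv\<^bsub>GL n\<^esub> g) *\<^sub>v w) f =
        (tensor_power d g\<^sup>T *\<^sub>v \<phi>) \<bullet> tensor_power_vec d (inv\<^bsub>GL n\<^esub> g *\<^sub>v u)"
      using eval[OF inv_u, of "tensor_power d g\<^sup>T *\<^sub>v \<phi>"] T' c(2) by simp
    also have "\<dots> = \<phi> \<bullet> (tensor_power d g *\<^sub>v tensor_power_vec d (inv\<^bsub>GL n\<^esub> g *\<^sub>v u))"
      unfolding tensor_power_transpose[OF gc, symmetric]
      by (rule transpose_vec_mult_scalar[OF T tensor_power_vec_carrier[OF inv_u] c(2)])
    also have "tensor_power d g *\<^sub>v tensor_power_vec d (inv\<^bsub>GL n\<^esub> g *\<^sub>v u) = tensor_power_vec d u"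
      using tensor_power_mult_vec[OF gc inv_u, of d] c(1)
      by (simp add: assoc_mult_mat_vec[OF gc inv_GL(2)[OF g] c(1), symmetric] inv_GL(4)[OF g])
    finally show ?thesis unfolding w_eq eval[OF c] .
  qed
  ultimately have "f \<in> plus_part (invariants n G ?m (test_rep n d))"
    unfolding plus_part_def invariants_def using f(1) by blast
  then show ?thesis using eval by blast
qed

section \<open>Eigenvalues of elements of the group\<close>

text \<open>If no degree up to \<open>D\<close> gave a \<open>\<sigma>\<close>-set, the infimum for
  that module would be at least \<open>D + 1\<close>. This includes the case of no admissible degree
  at all, where the infimum is \<open>\<infinity>\<close>.\<close>

lemma sigma_group_bound:
  assumes "sigma_group n G \<noteq> \<infinity>"
  shows "\<exists>D. \<forall>m \<rho>. G_module n G m \<rho> \<longrightarrow> (\<exists>d\<le>D. sigma_set n G m \<rho> (invariants_le n G m \<rho> d))"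
proof -
  obtain D where D: "sigma_group n G = enat D" using assms by auto
  have "\<exists>d\<le>D. sigma_set n G m \<rho> (invariants_le n G m \<rho> d)" if "G_module n G m \<rho>" for m \<rho>
  proof (rule ccontr)
    let ?S = "{d. sigma_set n G m \<rho> (invariants_le n G m \<rho> d)}"
    assume "\<not> ?thesis"
    then have "enat (Suc D) \<le> enat d" if "d \<in> ?S" for d
      using that by (auto simp: not_le[symmetric] not_less_eq_eq)
    then have "enat (Suc D) \<le> sigma_module n G m \<rho>"
      unfolding sigma_module_def by (rule INF_greatest)
    also have "\<dots> \<le> sigma_group n G"
      unfolding sigma_group_def using that by (intro SUP_upper2[of "(m, \<rho>)"]) auto
    finally show False by (simp add: D)
  qed
  then show ?thesis by blast
qed

lemma invariant_pow:
  assumes G: "subgroup G (GL n)" and f: "f \<in> invariants n G m \<rho>" and \<rho>: "G_module n G m \<rho>"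
    and g: "g \<in> G" and w: "w \<in> carrier_vec m"
  shows "eval_vec ((\<rho> g ^\<^sub>m k) *\<^sub>v w) f = eval_vec w f"
proof -
  have M: "\<rho> g \<in> carrier_mat m m"
    using \<rho> g carrier_GL_mat[of "\<rho> g" m] by (auto simp: G_module_def hom_def)
  have gGL: "g \<in> carrier (GL n)" using g subgroup.subset[OF G] by blast
  show ?thesis
    using w
  proof (induction k arbitrary: w)
    case 0
    then show ?case using M by simp
  next
    case (Suc k)
    have Mk: "\<rho> g ^\<^sub>m k \<in> carrier_mat m m" using M by (rule pow_carrier_mat)
    \<comment> \<open>Invariance is defined through inverses, so it is applied to the inverse of
      \<open>g\<close>.\<close>
    have "inv\<^bsub>GL n\<^esub> (inv\<^bsub>GL n\<^esub> g) = g" using group.inv_inv[OF group_GL gGL] .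
    then have "eval_vec (\<rho> g *\<^sub>v w) f = eval_vec w f"
      using f subgroup.m_inv_closed[OF G g] Suc.prems unfolding invariants_def by force
    moreover have "(\<rho> g ^\<^sub>m Suc k) *\<^sub>v w = (\<rho> g ^\<^sub>m k) *\<^sub>v (\<rho> g *\<^sub>v w)"
      using assoc_mult_mat_vec[OF Mk M Suc.prems] by simp
    ultimately show ?case using Suc.IH[of "\<rho> g *\<^sub>v w"] M Suc.prems by simp
  qed
qed

text \<open>Along the orbit of \<open>(v, \<phi>)\<close> under the powers of \<open>g\<close> a monomial of bidegree \<open>(a, b)\<close> is
  quasi-geometric with ratio \<open>\<kappa>\<^bsup>a - db\<^esup>\<close>, whereas invariants are constant there.\<close>

lemma invariant_vanishes_at_test_point:
  fixes g :: "'k::field mat"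
  assumes G: "subgroup G (GL n)" and g: "g \<in> G"
    and f: "f \<in> invariants n G (n + n ^ Suc D) (test_rep n (Suc D))" "const_term f = 0" "degree_le D f"
    and v: "v \<in> carrier_vec n" "char_op g [\<kappa>] v = 0\<^sub>v n"
    and l: "l \<in> carrier_vec n" "char_op (contragredient n g) (replicate r (inverse \<kappa>)) l = 0\<^sub>v n"
    and \<kappa>: "\<kappa> \<noteq> 0" "\<And>j. 1 \<le> j \<Longrightarrow> j \<le> Suc D * Suc D \<Longrightarrow> \<kappa> ^ j \<noteq> 1"
  shows "eval_vec (v @\<^sub>v tensor_power_vec (Suc D) l) f = 0"
proof -
  let ?d = "Suc D"
  let ?m = "n + n ^ ?d"
  let ?C = "contragredient n g"
  let ?w = "v @\<^sub>v tensor_power_vec ?d l"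
  have gGL: "g \<in> carrier (GL n)" using g subgroup.subset[OF G] by blast
  have gc: "g \<in> carrier_mat n n" using carrier_GL_mat[OF gGL] .
  have C: "?C \<in> carrier_mat n n" using contragredient_carrier[OF gGL] .
  have gk: "g ^\<^sub>m k \<in> carrier_mat n n" and Ck: "?C ^\<^sub>m k \<in> carrier_mat n n" for k
    using gc C by (auto intro: pow_carrier_mat)
  have w: "?w \<in> carrier_vec ?m" using v(1) tensor_power_vec_carrier[OF l(1)] by (rule append_carrier_vec)
  define w where "w k = ((g ^\<^sub>m k) *\<^sub>v v) @\<^sub>v tensor_power_vec ?d ((?C ^\<^sub>m k) *\<^sub>v l)" for k
  have w_k: "(test_rep n ?d g ^\<^sub>m k) *\<^sub>v ?w = w k" for k
  proof -
    have "test_rep n ?d g ^\<^sub>m k =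
        four_block_mat (g ^\<^sub>m k) (0\<^sub>m n (n ^ ?d)) (0\<^sub>m (n ^ ?d) n) (tensor_power ?d (?C ^\<^sub>m k))"
      unfolding test_rep_def pow_four_block_mat[OF gc tensor_power_carrier[OF C]]
      tensor_power_pow[OF C] ..
    then show ?thesis
      unfolding w_def tensor_power_mult_vec[OF Ck l(1), symmetric]
      using mult_mat_vec_split[OF gk tensor_power_carrier[OF Ck] v(1) tensor_power_vec_carrier[OF l(1)]]
      by (simp only:)
  qed
  have const: "eval_vec (w k) f = eval_vec ?w f" for k
    using invariant_pow[OF G f(1) G_module_test_rep[OF G] g w, of k] unfolding w_k .
  \<comment> \<open>The ratio of coordinate \<open>x\<close> along the orbit:
    \<open>\<kappa>\<close> on the first block, where \<open>v\<close> is an eigenvector, and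
    \<open>\<kappa>\<close> to the power \<open>-d\<close> on the tensor block.\<close>
  define \<gamma> where "\<gamma> x = (if x < n then \<kappa> else inverse \<kappa> ^ ?d)" for x
  have w_index: "w k $ x = (if x < n then ((g ^\<^sub>m k) *\<^sub>v v) $ x
      else tensor_power_vec ?d ((?C ^\<^sub>m k) *\<^sub>v l) $ (x - n))" if x: "x < ?m" for k x
  proof -
    have "dim_vec ((g ^\<^sub>m k) *\<^sub>v v) = n" using gc by simp
    moreover have "dim_vec (tensor_power_vec ?d ((?C ^\<^sub>m k) *\<^sub>v l)) = n ^ ?d"
      using tensor_power_vec_carrier[OF mult_mat_vec_carrier[OF Ck l(1)]] by (rule carrier_vecD)
    ultimately show ?thesis using x unfolding w_def by (subst index_append_vec(1)) simp_all
  qed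
  have coord: "quasi_geometric (\<gamma> x) (\<lambda>k. w k $ x)" if x: "x < ?m" for x
  proof (cases "x < n")
    case True
    then show ?thesis
      using quasi_geometric_coordinates[OF gc v(1) True, of 1 \<kappa>] v(2) w_index[OF x]
      by (simp add: \<gamma>_def)
  next
    case False
    have "w k $ x = tensor_power_vec ?d ((?C ^\<^sub>m k) *\<^sub>v l) $ (x - n)" for k
      using w_index[OF x] False by simp
    moreover have "quasi_geometric (inverse \<kappa> ^ ?d) (\<lambda>k. tensor_power_vec ?d ((?C ^\<^sub>m k) *\<^sub>v l) $ (x - n))"
      using mult_mat_vec_carrier[OF Ck l(1)] l(2) x False
      by (intro quasi_geometric_tensor_power_vec[where n = n] quasi_geometric_coordinates[OF C l(1)]) auto
    ultimately show ?thesis using False by (simp add: \<gamma>_def)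
  qed
  have keys_lt: "x < ?m" if "m \<in> Poly_Mapping.keys f" "x \<in> Poly_Mapping.keys m" for m x
    using f(1) that by (auto simp: invariants_def polys_in_def)
  define \<alpha> where "\<alpha> m = (\<Prod>x \<in> Poly_Mapping.keys m. \<gamma> x ^ Poly_Mapping.lookup m x)" for m
  have "\<alpha> m \<noteq> 1" if m: "m \<in> Poly_Mapping.keys f" for m
  proof
    assume 1: "\<alpha> m = 1"
    let ?K = "Poly_Mapping.keys m"
    \<comment> \<open>\<open>a\<close> and \<open>b\<close> are the degrees of \<open>m\<close> in
      the two blocks. The degree bound gives \<open>a + b \<le> D\<close>, and the missing constant
      term gives \<open>a + b > 0\<close>.\<close>
    define a where "a = (\<Sum>x \<in> {x \<in> ?K. x < n}. Poly_Mapping.lookup m x)"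
    define b where "b = (\<Sum>x \<in> {x \<in> ?K. \<not> x < n}. Poly_Mapping.lookup m x)"
    have split: "?K = {x \<in> ?K. x < n} \<union> {x \<in> ?K. \<not> x < n}" by blast
    have "mon_degree m = a + b"
      unfolding mon_degree_def a_def b_def by (subst split, subst sum.union_disjoint) auto
    then have ab: "a + b \<le> D" using f(3) m by (auto simp: degree_le_def)
    have "m \<noteq> 0" using m f(2) by (auto simp: const_term_def in_keys_iff)
    then obtain x where "x \<in> ?K" by fastforce
    then have "mon_degree m > 0" unfolding mon_degree_def by (intro sum_pos2[of _ x]) (auto simp: in_keys_iff)
    then have pos: "a + b > 0" by (simp add: \<open>mon_degree m = a + b\<close>)
    have "\<alpha> m = (\<Prod>x \<in> {x \<in> ?K. x < n}. \<gamma> x ^ Poly_Mapping.lookup m x) *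
        (\<Prod>x \<in> {x \<in> ?K. \<not> x < n}. \<gamma> x ^ Poly_Mapping.lookup m x)"
      unfolding \<alpha>_def by (subst split, subst prod.union_disjoint) auto
    also have "\<dots> = \<kappa> ^ a * (inverse \<kappa> ^ ?d) ^ b"
      unfolding a_def b_def power_sum by (intro arg_cong2[where f = "(*)"] prod.cong) (auto simp: \<gamma>_def)
    also have "\<dots> = \<kappa> ^ a / \<kappa> ^ (?d * b)"
      by (simp add: power_mult[symmetric] power_inverse[symmetric] field_simps del: power_Suc mult_Suc)
    finally have eq: "\<kappa> ^ a = \<kappa> ^ (?d * b)" using 1 \<kappa>(1) by simp
    \<comment> \<open>For \<open>b = 0\<close> the exponent \<open>a\<close> lies between
      \<open>1\<close> and \<open>D\<close>. For \<open>b > 0\<close> the choice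
      \<open>?d = D + 1\<close> forces \<open>a < ?d \<le> ?d * b\<close>, so
      \<open>?d * b - a\<close> is positive and at most \<open>?d * ?d\<close>. Both exponents are
      excluded for \<open>\<kappa>\<close>.\<close>
    show False
    proof (cases "b = 0")
      case True
      then show False using eq \<kappa>(2)[of a] pos ab by simp
    next
      case False
      then have ge: "?d \<le> ?d * b" by (cases b) simp_all
      have "?d * b \<le> ?d * ?d" using ab by (intro mult_le_mono2) simp
      then have j: "1 \<le> ?d * b - a" "?d * b - a \<le> ?d * ?d" using ge ab by linarith+
      have "\<kappa> ^ a * \<kappa> ^ (?d * b - a) = \<kappa> ^ a * 1"
        unfolding power_add[symmetric] using ge ab eq by simp
      then have "\<kappa> ^ (?d * b - a) = 1" using \<kappa>(1) by simp
      then show False using \<kappa>(2)[OF j] by blast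
    qed
  qed
  moreover have "quasi_geometric (\<alpha> m) (\<lambda>k. Poly_Mapping.lookup f m * eval_mon (($) (w k)) m)"
    if "m \<in> Poly_Mapping.keys f" for m
    unfolding \<alpha>_def eval_mon_def
    by (intro quasi_geometric_scale quasi_geometric_prod quasi_geometric_power coord keys_lt[OF that])
  moreover have "(\<Sum>m \<in> Poly_Mapping.keys f. Poly_Mapping.lookup f m * eval_mon (($) (w k)) m) = eval_vec ?w f" for k
    using const[of k] unfolding eval_vec_def eval_mpol_def .
  ultimately show ?thesis
    by (intro sum_quasi_geometric_const[of "Poly_Mapping.keys f" \<alpha>
      "\<lambda>m k. Poly_Mapping.lookup f m * eval_mon (($) (w k)) m"]) auto
qed

text \<open>If \<open>\<kappa>\<close> had no such order, all invariants of degree at most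
  \<open>D\<close> without constant term would vanish at the test point, although the evaluation
  pairing shows that it lies outside the nullcone.\<close>

lemma eigenvalue_order_bound:
  fixes G :: "'k::alg_closed_field mat set"
  assumes G: "subgroup G (GL n)"
    and D: "\<forall>m \<rho>. G_module n G m \<rho> \<longrightarrow> (\<exists>d\<le>D. sigma_set n G m \<rho> (invariants_le n G m \<rho> d))"
    and g: "g \<in> G" and ev: "eigenvalue g \<kappa>"
  shows "\<exists>j. 1 \<le> j \<and> j \<le> Suc D * Suc D \<and> \<kappa> ^ j = 1"
proof (rule ccontr)
  assume "\<not> ?thesis"
  then have ord: "\<kappa> ^ j \<noteq> 1" if "1 \<le> j" "j \<le> Suc D * Suc D" for j using that by blast
  let ?d = "Suc D"
  let ?m = "n + n ^ ?d"
  let ?C = "contragredient n g"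
  have gGL: "g \<in> carrier (GL n)" using g subgroup.subset[OF G] by blast
  have gc: "g \<in> carrier_mat n n" using carrier_GL_mat[OF gGL] .
  note gi = inv_GL[OF gGL]
  have C: "?C \<in> carrier_mat n n" using contragredient_carrier[OF gGL] .
  obtain v where ev: "eigenvector g v \<kappa>" using ev by (auto simp: eigenvalue_def)
  then have v: "v \<in> carrier_vec n" "v \<noteq> 0\<^sub>v n" "g *\<^sub>v v = \<kappa> \<cdot>\<^sub>v v"
    using gc by (auto simp: eigenvector_def)
  have iv: "v = \<kappa> \<cdot>\<^sub>v (inv\<^bsub>GL n\<^esub> g *\<^sub>v v)"
  proof -
    have "inv\<^bsub>GL n\<^esub> g *\<^sub>v (g *\<^sub>v v) = v"
      using gi(3) v(1) by (simp add: assoc_mult_mat_vec[OF gi(2) gc v(1), symmetric])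
    then show ?thesis using v(1) gi(2) by (simp add: v(3) mult_mat_vec[OF gi(2) v(1)])
  qed
  have \<kappa>0: "\<kappa> \<noteq> 0"
  proof
    assume "\<kappa> = 0"
    then have "v = 0\<^sub>v n" using iv gi(2) v(1) by (intro eq_vecI) (auto simp: vec_eq_iff)
    then show False using v(2) by blast
  qed
  have iv': "inv\<^bsub>GL n\<^esub> g *\<^sub>v v = inverse \<kappa> \<cdot>\<^sub>v v"
    using arg_cong[OF iv, of "\<lambda>x. inverse \<kappa> \<cdot>\<^sub>v x"] \<kappa>0 by (simp add: smult_smult_assoc)
  \<comment> \<open>The transpose of \<open>?C\<close> is the inverse of \<open>g\<close>, for which
    \<open>v\<close> is an eigenvector. This is the hypothesis needed to find \<open>l\<close>; a
    unit vector at a nonzero coordinate of \<open>v\<close> serves as its starting vector.\<close>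
  have adj: "(?C *\<^sub>v y) \<bullet> v = inverse \<kappa> * (y \<bullet> v)" if y: "y \<in> carrier_vec n" for y
    unfolding contragredient_def transpose_vec_mult_scalar[OF gi(2) v(1) y] iv' using y v(1) by simp
  obtain i where i: "i < n" "v $ i \<noteq> 0" using v(1,2) by (metis carrier_vecD eq_vecI index_zero_vec)
  have "unit_vec n i \<bullet> v \<noteq> 0" using i v(1) by simp
  then obtain l r where l: "l \<in> carrier_vec n" "l \<bullet> v \<noteq> 0"
      "char_op ?C (replicate r (inverse \<kappa>)) l = 0\<^sub>v n"
    using generalized_eigenvector_exists[OF C unit_vec_carrier v(1) adj] by blast
  let ?w = "v @\<^sub>v tensor_power_vec ?d l"
  have w: "?w \<in> carrier_vec ?m" using v(1) tensor_power_vec_carrier[OF l(1)] by (rule append_carrier_vec)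
  obtain F where F: "F \<in> plus_part (invariants n G ?m (test_rep n ?d))"
      "\<forall>u \<in> carrier_vec n. \<forall>\<phi> \<in> carrier_vec (n ^ ?d). eval_vec (u @\<^sub>v \<phi>) F = \<phi> \<bullet> tensor_power_vec ?d u"
    using evaluation_invariant[OF G] by blast
  have "eval_vec ?w F = (l \<bullet> v) ^ ?d"
    using F(2) v(1) tensor_power_vec_carrier[OF l(1)] tensor_power_vec_scalar_prod[OF l(1) v(1)] by metis
  then have "eval_vec ?w F \<noteq> 0" using l(2) by simp
  then have "?w \<notin> nullcone n G ?m (test_rep n ?d)"
    using F(1) unfolding nullcone_def by blast
  moreover obtain d where d: "d \<le> D"
    "sigma_set n G ?m (test_rep n ?d) (invariants_le n G ?m (test_rep n ?d) d)"
    using D G_module_test_rep[OF G] by blast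
  ultimately obtain f where f: "f \<in> plus_part (invariants_le n G ?m (test_rep n ?d) d)" "eval_vec ?w f \<noteq> 0"
    using w unfolding sigma_set_def by blast
  have "f \<in> invariants n G ?m (test_rep n ?d)" "const_term f = 0" "degree_le D f"
    using f(1) d(1) by (auto simp: plus_part_def invariants_le_def degree_le_def)
  moreover have "char_op g [\<kappa>] v = 0\<^sub>v n" using ev eigenvector_char_matrix[OF gc] by simp
  ultimately show False
    using invariant_vanishes_at_test_point[OF G g _ _ _ v(1) _ l(1,3) \<kappa>0 ord] f(2) by blast
qed

section \<open>The identity component\<close>

text \<open>The characteristic polynomial is monic and splits, with the eigenvalues as roots. The
  matrix is written out entrywise so that the determinant is visibly polynomial in the entries of
  \<open>A\<close>.\<close>

lemma det_scalar_minus: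
  fixes A :: "'k::alg_closed_field mat"
  assumes A: "A \<in> carrier_mat n n"
  shows "\<exists>as. length as = n \<and> (\<forall>a \<in> set as. eigenvalue A a) \<and>
    (\<forall>c. det (mat n n (\<lambda>(i, j). (if i = j then c else 0) - A $$ (i, j))) = (\<Prod>a\<leftarrow>as. c - a))"
proof -
  note dm = degree_monic_char_poly[OF A]
  then have "char_poly A \<noteq> 0" by auto
  then obtain M where M: "size M = degree (char_poly A)"
      "char_poly A = smult (lead_coeff (char_poly A)) (\<Prod>a\<in>#M. [:- a, 1:])"
    using alg_closed_imp_factorization by blast
  obtain as where as: "M = mset as" using ex_mset[of M] by blast
  have cp: "char_poly A = (\<Prod>a\<leftarrow>as. [:- a, 1:])"
    using M(2) dm unfolding as by (simp add: prod_mset_prod_list flip: mset_map)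
  have poly: "poly (char_poly A) c = (\<Prod>a\<leftarrow>as. c - a)" for c
    unfolding cp by (induction as) (auto simp: algebra_simps)
  have "- char_matrix A c = mat n n (\<lambda>(i, j). (if i = j then c else 0) - A $$ (i, j))" for c
    using A by (intro eq_matI) (auto simp: char_matrix_def)
  then have "det (mat n n (\<lambda>(i, j). (if i = j then c else 0) - A $$ (i, j))) = (\<Prod>a\<leftarrow>as. c - a)" for c
    using char_poly_matrix[OF A, of c] poly by simp
  moreover have "eigenvalue A a" if "a \<in> set as" for a
    unfolding eigenvalue_root_char_poly[OF A] poly using that by (auto simp: prod_list_zero_iff)
  moreover have "length as = n" using M(1) dm as by simp
  ultimately show ?thesis by blast
qed

lemma unipotent_identity_component:
  fixes G :: "'k::alg_closed_field mat set"
  assumes G: "linear_algebraic_group n G" and S: "finite S" "\<And>g a. g \<in> G \<Longrightarrow> eigenvalue g a \<Longrightarrow> a \<in> S"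
  shows "unipotent_group n (identity_component n G)"
  unfolding unipotent_group_def
proof
  fix A assume A0: "A \<in> identity_component n G"
  have sub: "subgroup G (GL n)" using G by (simp add: linear_algebraic_group_def)
  have GGL: "G \<subseteq> carrier (GL n)" using sub by (rule subgroup.subset)
  have AG: "A \<in> G"
  proof -
    have "identity_component n G \<subseteq> topspace (subtopology (zariski_GL n) G)"
      unfolding identity_component_def by (rule connected_component_of_subset_topspace)
    then show ?thesis using A0 by auto
  qed
  have Ac: "A \<in> carrier_mat n n" using AG GGL carrier_GL_mat by blast
  \<comment> \<open>\<open>f c\<close> is \<open>det (c - A)\<close> as a polynomial in the entries.
    On \<open>G\<close> it is a product of \<open>n\<close> factors \<open>c - a\<close> with
    \<open>a\<close> in the finite set \<open>S\<close>, hence takes finitely many values.\<close>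
  define f :: "'k \<Rightarrow> (nat \<times> nat \<Rightarrow> 'k) \<Rightarrow> 'k" where
    "f c a = det (mat n n (\<lambda>ij. (if fst ij = snd ij then c else 0) - a ij))" for c a
  have f_eq: "f c (($$) B) = det (mat n n (\<lambda>(i, j). (if i = j then c else 0) - B $$ (i, j)))" for c B
    unfolding f_def by (rule arg_cong[where f = det]) (auto intro!: eq_matI)
  have "finite ((\<lambda>B. f c (($$) B)) ` G)" for c
  proof (rule finite_subset)
    show "(\<lambda>B. f c (($$) B)) ` G \<subseteq> (\<lambda>as. \<Prod>a\<leftarrow>as. c - a) ` {as. set as \<subseteq> S \<and> length as = n}"
    proof
      fix y assume "y \<in> (\<lambda>B. f c (($$) B)) ` G"
      then obtain B where B: "B \<in> G" "y = f c (($$) B)" by blast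
      then have "B \<in> carrier_mat n n" using GGL carrier_GL_mat by blast
      then obtain as where "length as = n" "\<forall>a \<in> set as. eigenvalue B a" "y = (\<Prod>a\<leftarrow>as. c - a)"
        using det_scalar_minus[of B n] B(2) f_eq by metis
      then show "y \<in> (\<lambda>as. \<Prod>a\<leftarrow>as. c - a) ` {as. set as \<subseteq> S \<and> length as = n}"
        using S(2)[OF B(1)] by blast
    qed
  qed (use S(1) finite_lists_length_eq in blast)
  moreover have "polyfun (mat_vars n) (f c)" for c
    unfolding f_def by (intro polyfun_det polyfun_diff polyfun_const polyfun_var) auto
  ultimately have const: "f c (($$) A) = f c (($$) (1\<^sub>m n))" for c
    using finite_valued_polyfun_const_on_identity_component[OF G _ _ A0] by blast
  have one: "f c (($$) (1\<^sub>m n)) = (c - 1) ^ n" for c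
  proof -
    have "mat n n (\<lambda>(i, j). (if i = j then c else 0) - 1\<^sub>m n $$ (i, j)) = (c - 1) \<cdot>\<^sub>m 1\<^sub>m n"
      by (intro eq_matI) auto
    then show ?thesis unfolding f_eq by simp
  qed
  show "unipotent_mat n A"
  proof (rule unipotent_if_eigenvalues_one[OF Ac])
    fix a assume a: "eigenvalue A a"
    \<comment> \<open>Now take \<open>c\<close> to be the eigenvalue \<open>a\<close> itself: the
      determinant vanishes there but equals \<open>(a - 1) ^ n\<close>.\<close>
    have "f a (($$) A) = poly (char_poly A) a"
      unfolding char_poly_matrix[OF Ac] f_eq using Ac
      by (intro arg_cong[where f = det]) (auto intro!: eq_matI simp: char_matrix_def)
    then have "(a - 1) ^ n = 0" using a eigenvalue_root_char_poly[OF Ac] const one by simp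
    then show "a = 1" by simp
  qed
qed

theorem corollary4p3:
  fixes G :: "'k::alg_closed_field mat set" and n :: nat
  assumes "linear_algebraic_group n G"
    and "sigma_group n G \<noteq> \<infinity>"
  shows "unipotent_group n (identity_component n G) \<and>
    (finite G \<or>
      infinite (identity_component n G) \<and> unipotent_group n (identity_component n G))"
proof -
  have sub: "subgroup G (GL n)" using assms(1) by (simp add: linear_algebraic_group_def)
  obtain D where D: "\<forall>m \<rho>. G_module n G m \<rho> \<longrightarrow>
      (\<exists>d\<le>D. sigma_set n G m \<rho> (invariants_le n G m \<rho> d))"
    using sigma_group_bound[OF assms(2)] by blast
  \<comment> \<open>All possible eigenvalues of elements of \<open>G\<close>: roots of unity of
    bounded order, finitely many as roots of the polynomials \<open>X ^ j - 1\<close>.\<close>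
  let ?S = "\<Union>j \<in> {1..Suc D * Suc D}. {a :: 'k. a ^ j = 1}"
  have "finite {a :: 'k. a ^ j = 1}" if "j \<ge> 1" for j
  proof -
    have "{a :: 'k. a ^ j = 1} = {a. poly (monom 1 j - 1) a = 0}" by (auto simp: poly_monom)
    moreover have "monom 1 j - 1 \<noteq> (0 :: 'k poly)"
    proof
      assume "monom 1 j - 1 = (0 :: 'k poly)"
      then have "coeff (monom 1 j - 1 :: 'k poly) j = 0" by simp
      then show False using that by simp
    qed
    ultimately show ?thesis using poly_roots_finite by metis
  qed
  then have "finite ?S" by auto
  moreover have "a \<in> ?S" if "g \<in> G" "eigenvalue g a" for g a
    using eigenvalue_order_bound[OF sub D that] by auto
  ultimately have "unipotent_group n (identity_component n G)"
    by (rule unipotent_identity_component[OF assms(1)])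
  \<comment> \<open>The dichotomy: if the identity component is not infinite, then \<open>G\<close>
    is finite.\<close>
  then show ?thesis using finite_if_finite_identity_component[OF assms(1)] by blast
qed

end
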